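(* Let $T$ be the cutting and stacking transformation of $X=[0,\infty)$ (with Lebesgue measure $\mu$) defined by the columns $\mathcal{C}_k$, $k\ge 1$, described in the context: $\mathcal{C}_1=\{[0,1)\}$, and $\mathcal{C}_{k+1}$ is obtained by cutting $\mathcal{C}_k$ (of height $h_k$) into four equal-width subcolumns, adding $h_k$ spacers on top of the second subcolumn and one spacer on top of the fourth subcolumn, and stacking from left to right. Then for every finite sequence of nonzero integers $\{k_1,\ldots,k_r\}$ ($r\ge 1$), the transformation $T^{k_1}\times\cdots\times T^{k_r}$ of $\Pi_{i=1}^{r}X$, equipped with the product measure $\nu=\mu^r$, is ergodic.
   Context: All sets are Lebesgue measurable and transformations are considered up to sets of measure zero; $T$ below is an invertible (mod null sets) measure preserving transformation of $([0,\infty),\mu)$, where $\mu$ is Lebesgue measure, so negative powers of $T$ make sense almost everywhere. An invertible measure preserving transformation is ergodic if every invariant measurable set is null or has null complement. Columns. A column of height $h$ is an ordered collection of $h$ pairwise disjoint intervals $B^0,B^1,\ldots,B^{h-1}$ (levels) of the same positive length; it partially defines a transformation by sending $B^i$ to $B^{i+1}$ by translation, for $0\le i\le h-2$. The interval $B^0$ is the base and $B^{h-1}$ is the top level. Construction of $T$. The column $\mathcal{C}_1$ has base $B_1=[0,1)$ and height $h_1=1$. Given a column $\mathcal{C}_k$ with base $B_k=[0,\frac{1}{4^{k-1}})$ and height $h_k$, cut $\mathcal{C}_k$ vertically three times so that $B_k$ is cut into the four intervals $B_{k,1}=[0,\frac{1}{4^k})$, $B_{k,2}=[\frac{1}{4^k},\frac12\cdot\frac{1}{4^{k-1}})$,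 $B_{k,3}=[\frac12\cdot\frac{1}{4^{k-1}},\frac34\cdot\frac{1}{4^{k-1}})$, $B_{k,4}=[\frac34\cdot\frac{1}{4^{k-1}},\frac{1}{4^{k-1}})$; each level of $\mathcal{C}_k$ is correspondingly cut into four intervals of length $4^{-k}$ by the translations of the column. This gives four subcolumns of height $h_k$ with bases $B_{k,1},\ldots,B_{k,4}$. Put $h_k$ spacers on top of the subcolumn with base $B_{k,2}$, and one spacer on top of the subcolumn with base $B_{k,4}$ (spacers are new left-closed, right-open intervals of length $4^{-k}$, pairwise disjoint and disjoint from all levels of $\mathcal{C}_k$). Then stack from left to right: the top level (the top spacer, if there is one) of each of the first three subcolumns is sent by translation to the base of the subcolumn immediately to its right. The resulting column $\mathcal{C}_{k+1}$ has base $B_{k+1}=[0,\frac{1}{4^k})$ and height $h_{k+1}=5h_k+1$. The spacers are chosen from $[0,\infty)$ so that the union of all the columns is $X=[0,\infty)$ (for instance, at each stage they are taken consecutively from the part of $[0,\infty)$ immediately to the right of the union of the levels of $\mathcal{C}_k$). The partial translations defined by the columns extend one another, and $T$ is their common extension to $X$. *)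

theory Defs
  imports "HOL-Analysis.Analysis"
begin

text \<open>
  A column is represented by the common length \<open>w\<close> of its levels and the list \<open>bs\<close> of the left
  endpoints of its levels, from the base (first entry) to the top level (last entry).
\<close>

definition level :: "real \<Rightarrow> real \<Rightarrow> real set" where
  "level w a = {a..<a + w}"

text \<open>The length \<open>1 / 4 ^ (k - 1)\<close> of the levels of the \<open>k\<close>-th column, \<open>k \<ge> 1\<close>.\<close>

definition col_width :: "nat \<Rightarrow> real" where
  "col_width k = 1 / 4 ^ (k - 1)"

text \<open>
  Spacers of length \<open>w / 4\<close> that can be added to the column \<open>(w, bs)\<close>: \<open>length bs\<close> of them, listed in
  \<open>ss\<close> from bottom to top, for the second subcolumn, and one, \<open>s\<close>, for the fourth.
\<close>

definition valid_spacers :: "real \<Rightarrow> real list \<Rightarrow> real list \<Rightarrow> real \<Rightarrow> bool" where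
  "valid_spacers w bs ss s \<longleftrightarrow>
     length ss = length bs \<and>
     (\<forall>a\<in>set (ss @ [s]). level (w / 4) a \<subseteq> {0..}) \<and>
     disjoint_family_on (\<lambda>i. level (w / 4) ((ss @ [s]) ! i)) {..<length (ss @ [s])} \<and>
     (\<forall>a\<in>set (ss @ [s]). \<forall>b\<in>set bs. level (w / 4) a \<inter> level w b = {})"

definition subcolumn :: "real \<Rightarrow> real list \<Rightarrow> nat \<Rightarrow> real list" where
  "subcolumn w bs j = map (\<lambda>a. a + real j * (w / 4)) bs"

definition cut_stack :: "real \<Rightarrow> real list \<Rightarrow> real list \<Rightarrow> real \<Rightarrow> real list" where
  "cut_stack w bs ss s =
     subcolumn w bs 0 @ (subcolumn w bs 1 @ ss) @ subcolumn w bs 2 @ (subcolumn w bs 3 @ [s])"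

text \<open>
  The construction leaves the positions of the spacers free, subject to the columns exhausting
  \<open>[0, \<infinity>)\<close>; so this is a predicate on the sequence \<open>C 1, C 2, \<dots>\<close> of columns. The entry \<open>C 0\<close> is unused.
\<close>

definition column_sequence :: "(nat \<Rightarrow> real list) \<Rightarrow> bool" where
  "column_sequence C \<longleftrightarrow>
     C 1 = [0] \<and>
     (\<forall>k\<ge>1. \<exists>ss s. valid_spacers (col_width k) (C k) ss s \<and>
                    C (Suc k) = cut_stack (col_width k) (C k) ss s) \<and>
     (\<Union>k\<in>{1..}. \<Union>a\<in>set (C k). level (col_width k) a) = {0..}"

text \<open>
  The common extension of the translations \<open>B\<^sup>i \<rightarrow> B\<^sup>i\<^sup>+\<^sup>1\<close> defined by the columns. Every point of
  \<open>[0, \<infinity>)\<close> lies in a level below the top one in some column, and the translations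
  extend one another, so \<open>THE\<close> denotes the intended value at every point of \<open>[0, \<infinity>)\<close>.
\<close>

definition cs_map :: "(nat \<Rightarrow> real list) \<Rightarrow> real \<Rightarrow> real" where
  "cs_map C x = (THE y. \<exists>k\<ge>1. \<exists>i. Suc i < length (C k) \<and>
     x \<in> level (col_width k) (C k ! i) \<and> y = x + (C k ! Suc i - C k ! i))"

text \<open>
  Integer powers of an injective map \<open>T\<close> of \<open>X\<close> into itself whose range is all of \<open>X\<close> up to a null set.
  Outside the range the inverse is arbitrarily taken to be the identity
  (for \<open>cs_map\<close> the range is \<open>[0, \<infinity>)\<close> without the point \<open>0\<close>).
\<close>

definition inverse_on :: "'a set \<Rightarrow> ('a \<Rightarrow> 'a) \<Rightarrow> 'a \<Rightarrow> 'a" where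
  "inverse_on X T y = (if y \<in> T ` X then inv_into X T y else y)"

definition int_power_on :: "'a set \<Rightarrow> ('a \<Rightarrow> 'a) \<Rightarrow> int \<Rightarrow> 'a \<Rightarrow> 'a" where
  "int_power_on X T k = (if 0 \<le> k then T ^^ nat k else inverse_on X T ^^ nat (- k))"

definition measure_preserving_map :: "'a measure \<Rightarrow> ('a \<Rightarrow> 'a) \<Rightarrow> bool" where
  "measure_preserving_map M T \<longleftrightarrow>
     T \<in> measurable M M \<and> (\<forall>A\<in>sets M. emeasure M (T -` A \<inter> space M) = emeasure M A)"

definition invertible_mod_null :: "'a measure \<Rightarrow> ('a \<Rightarrow> 'a) \<Rightarrow> bool" where
  "invertible_mod_null M T \<longleftrightarrow>
     (\<exists>S\<in>measurable M M. (AE x in M. S (T x) = x) \<and> (AE x in M. T (S x) = x))"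

text \<open>Invariance of a set is understood up to null sets.\<close>

definition ergodic_map :: "'a measure \<Rightarrow> ('a \<Rightarrow> 'a) \<Rightarrow> bool" where
  "ergodic_map M T \<longleftrightarrow>
     measure_preserving_map M T \<and> invertible_mod_null M T \<and>
     (\<forall>A\<in>sets M. sym_diff (T -` A \<inter> space M) A \<in> null_sets M \<longrightarrow>
        A \<in> null_sets M \<or> space M - A \<in> null_sets M)"

definition half_line :: "real measure" where
  "half_line = lebesgue_on {0..}"

text \<open>
  \<open>X\<^sup>r\<close> with \<open>\<mu>\<^sup>r\<close>, completed, so that the measurable sets are the Lebesgue measurable ones.
\<close>

definition power_space :: "nat \<Rightarrow> (nat \<Rightarrow> real) measure" where
  "power_space r = completion (\<Pi>\<^sub>M i\<in>{..<r}. half_line)"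

definition product_map :: "nat \<Rightarrow> (nat \<Rightarrow> 'a \<Rightarrow> 'a) \<Rightarrow> (nat \<Rightarrow> 'a) \<Rightarrow> (nat \<Rightarrow> 'a)" where
  "product_map r S x = (\<lambda>i\<in>{..<r}. S i (x i))"

text \<open>Taking the spacers consecutively from the right of the previous column is an admissible choice.\<close>

primrec consecutive_columns :: "nat \<Rightarrow> real list" where
  "consecutive_columns 0 = [0]"
| "consecutive_columns (Suc n) =
     (let bs = consecutive_columns n; h = length bs; w = 1 / 4 ^ n in
      cut_stack w bs (map (\<lambda>i. real h * w + real i * (w / 4)) [0..<h]) (real h * w + real h * (w / 4)))"

lemma level_grid_Union:
  assumes "w > 0"
  shows "(\<Union>i<n. level w (c + real i * w)) = {c..<c + real n * w}"
proof (induction n)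
  case (Suc n)
  have "{c..<c + real n * w} \<union> {c + real n * w..<c + real n * w + w} = {c..<c + real n * w + w}"
    using assms by (intro ivl_disj_un) auto
  then show ?case
    using Suc by (simp add: lessThan_Suc level_def Un_commute algebra_simps)
qed auto

lemma level_split4:
  assumes "w > 0"
  shows "level w a = level (w/4) a \<union> level (w/4) (a + w/4) \<union> level (w/4) (a + 2*(w/4)) \<union> level (w/4) (a + 3*(w/4))"
  using assms by (auto simp: level_def)

lemma Union_cut_stack:
  assumes "w > 0"
  shows "(\<Union>a\<in>set (cut_stack w bs ss s). level (w/4) a) =
         (\<Union>a\<in>set bs. level w a) \<union> (\<Union>a\<in>set (ss @ [s]). level (w/4) a)"
  by (auto simp: cut_stack_def subcolumn_def level_split4[OF assms])

lemma consecutive_spacers: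
  fixes w :: real
  assumes w: "w > 0" and U: "(\<Union>a\<in>set bs. level w a) = {0..<real h * w}" and h: "h = length bs"
  defines "ss \<equiv> map (\<lambda>i. real h * w + real i * (w / 4)) [0..<h]"
  defines "s \<equiv> real h * w + real h * (w / 4)"
  shows "valid_spacers w bs ss s"
    and "(\<Union>a\<in>set (cut_stack w bs ss s). level (w/4) a) = {0..<real (5 * h + 1) * (w/4)}"
proof -
  have eq: "ss @ [s] = map (\<lambda>i. real h * w + real i * (w / 4)) [0..<Suc h]"
    by (simp add: ss_def s_def)
  have S: "(\<Union>a\<in>set (ss @ [s]). level (w/4) a) = {real h * w..<real h * w + real (Suc h) * (w/4)}"
    using level_grid_Union[of "w/4" "real h * w" "Suc h"] w
    unfolding eq by (simp add: atLeast0LessThan lessThan_Suc)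
  have ge: "x \<ge> real h * w" if "a \<in> set (ss @ [s])" "x \<in> level (w/4) a" for a x
    using S that by (metis UN_I atLeastLessThan_iff)
  have lt: "x < real h * w" if "b \<in> set bs" "x \<in> level w b" for b x
    using U that by (metis UN_I atLeastLessThan_iff)
  have nn: "0 \<le> real h * w" using w by simp
  have grid: "level (w/4) (c + real i * (w/4)) \<inter> level (w/4) (c + real j * (w/4)) = {}"
    if "i < j" for i j c
  proof -
    have "(real i + 1) * (w/4) \<le> real j * (w/4)"
      using that w by (intro mult_right_mono) auto
    then show ?thesis by (auto simp: level_def algebra_simps)
  qed
  have "disjoint_family_on (\<lambda>i. level (w / 4) ((ss @ [s]) ! i)) {..<length (ss @ [s])}"
    unfolding disjoint_family_on_def
  proof (intro ballI impI)
    fix i j assume *: "i \<in> {..<length (ss @ [s])}" "j \<in> {..<length (ss @ [s])}" "i \<noteq> j"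
    have nth: "(ss @ [s]) ! m = real h * w + real m * (w/4)" if "m < length (ss @ [s])" for m
      using that unfolding eq by (simp del: upt_Suc)
    show "level (w / 4) ((ss @ [s]) ! i) \<inter> level (w / 4) ((ss @ [s]) ! j) = {}"
      using * grid[of i j] grid[of j i] by (simp only: nth lessThan_iff) (metis Int_commute nat_neq_iff)
  qed
  moreover have "length ss = length bs" by (simp add: ss_def h)
  moreover have "\<forall>a\<in>set (ss @ [s]). level (w / 4) a \<subseteq> {0..}"
    using ge nn by fastforce
  moreover have "\<forall>a\<in>set (ss @ [s]). \<forall>b\<in>set bs. level (w / 4) a \<inter> level w b = {}"
    using ge lt by (metis disjoint_iff linorder_not_less)
  ultimately show "valid_spacers w bs ss s"
    unfolding valid_spacers_def by blast
  have "{0..<real h * w} \<union> {real h * w..<real h * w + real (Suc h) * (w/4)}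
      = {0..<real h * w + real (Suc h) * (w/4)}"
    using nn w by (intro ivl_disj_un) auto
  moreover have "real h * w + real (Suc h) * (w/4) = real (5 * h + 1) * (w/4)"
    by (simp add: field_simps)
  ultimately show "(\<Union>a\<in>set (cut_stack w bs ss s). level (w/4) a) = {0..<real (5 * h + 1) * (w/4)}"
    unfolding Union_cut_stack[OF w] S U by (simp only:)
qed

lemma consecutive_columns_Union:
  "(\<Union>a\<in>set (consecutive_columns n). level (1 / 4 ^ n) a)
     = {0..<real (length (consecutive_columns n)) * (1 / 4 ^ n)}"
proof (induction n)
  case (Suc n)
  have len: "length (consecutive_columns (Suc n)) = 5 * length (consecutive_columns n) + 1"
    by (simp add: Let_def cut_stack_def subcolumn_def)
  show ?case
    using consecutive_spacers(2)[OF _ Suc refl]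
    unfolding len by (simp add: Let_def mult.commute)
qed (simp add: level_def)

lemma column_sequence_consecutive: "column_sequence (\<lambda>k. consecutive_columns (k - 1))"
  unfolding column_sequence_def
proof (intro conjI allI impI)
  fix k :: nat assume "1 \<le> k"
  then obtain n where k: "k = Suc n" by (cases k) auto
  show "\<exists>ss s. valid_spacers (col_width k) (consecutive_columns (k - 1)) ss s \<and>
      consecutive_columns (Suc k - 1) = cut_stack (col_width k) (consecutive_columns (k - 1)) ss s"
    using consecutive_spacers(1)[OF _ consecutive_columns_Union[of n] refl]
    unfolding k col_width_def diff_Suc_1 consecutive_columns.simps Let_def
    by (intro exI conjI) (auto intro: refl)
next
  have len: "5 ^ n \<le> length (consecutive_columns n)" for n
    by (induction n) (simp_all add: Let_def cut_stack_def subcolumn_def)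
  have big: "real (length (consecutive_columns n)) * (1 / 4 ^ n) \<ge> (5/4) ^ n" for n
  proof -
    have "(5::real) ^ n \<le> real (length (consecutive_columns n))"
      using len[of n] by (metis of_nat_le_iff of_nat_numeral of_nat_power)
    then show ?thesis by (simp add: power_divide divide_right_mono)
  qed
  have U: "(\<Union>a\<in>set (consecutive_columns (k - 1)). level (col_width k) a)
      = {0..<real (length (consecutive_columns (k - 1))) * (1 / 4 ^ (k - 1))}" for k
    unfolding col_width_def by (rule consecutive_columns_Union)
  have "x \<in> (\<Union>k\<in>{1..}. {0..<real (length (consecutive_columns (k - 1))) * (1 / 4 ^ (k - 1))})"
    if "x \<ge> 0" for x :: real
  proof -
    obtain n where "x < (5/4) ^ n"
      using real_arch_pow[of "5/4" x] by auto
    then have "x \<in> {0..<real (length (consecutive_columns n)) * (1 / 4 ^ n)}"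
      using that big[of n] by (simp add: order.strict_trans2)
    then show ?thesis by (intro UN_I[of "Suc n"]) auto
  qed
  then show "(\<Union>k\<in>{1..}. \<Union>a\<in>set (consecutive_columns (k - 1)). level (col_width k) a) = {0..}"
    unfolding U by (intro equalityI subsetI) auto
qed simp

end

theory Submission
  imports Defs
begin

text \<open>
  Write \<open>h\<^sub>m\<close> for the height of the \<open>m\<close>-th column. The column \<open>m + 1\<close> contains four copies of column
  \<open>m\<close>, at heights \<open>0\<close>, \<open>h\<^sub>m\<close>, \<open>3 h\<^sub>m\<close> and \<open>4 h\<^sub>m\<close>, hence column \<open>m + p\<close> contains \<open>4\<^sup>p\<close> copies of column
  \<open>m\<close>, at the heights \<open>o\<^sub>0 h\<^sub>m + \<dots> + o\<^sub>p\<^sub>-\<^sub>1 h\<^sub>m\<^sub>+\<^sub>p\<^sub>-\<^sub>1\<close> with digits \<open>o\<^sub>j \<in> {0, 1, 3, 4}\<close>. If two copies are \<open>z\<close>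
  apart, then the power \<open>z\<close> of the transformation carries a piece of each level of column \<open>m\<close>, a
  fraction \<open>4\<^sup>-\<^sup>p\<close> of it, by translation to a piece of the same level.

  The combinatorial heart is that many integers are such distances. The differences of two digits are
  all the integers from \<open>-4\<close> to \<open>4\<close>, so distances have signed expansions to base essentially \<open>5\<close>; and
  \<open>5 h\<^sub>m = h\<^sub>m\<^sub>+\<^sub>1 - 1\<close>, so each carry changes the number by one unit. Since carries can be made at will,
  all numbers \<open>k h\<^sub>m + g\<close> with \<open>g \<ge> k > 0\<close> are distances, with a \<open>p\<close> that depends on \<open>k\<close> and \<open>g\<close> but not on
  \<open>m\<close> (\<open>copy_distance_height_plus\<close>). Consequently, for nonzero \<open>k\<^sub>1, \<dots>, k\<^sub>r\<close> and arbitrary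
  \<open>d\<^sub>1, \<dots>, d\<^sub>r\<close>, if \<open>t\<close> is large and \<open>n = h\<^sub>m + t\<close>, then all the numbers \<open>k\<^sub>i n - d\<^sub>i\<close> are distances
  between copies of column \<open>m\<close> in column \<open>m + p\<close>, where \<open>p\<close> does not depend on \<open>m\<close>
  (\<open>simultaneous_copy_distances\<close>).

  Ergodicity follows by a density argument. Let \<open>A\<close> and \<open>B\<close> be sets of positive measure in the product.
  They nearly fill two products \<open>I\<close> and \<open>J\<close> of levels of one column (\<open>dense_box\<close>); let \<open>d\<^sub>i\<close> be the
  difference of the indices of the \<open>i\<close>-th factors. The set \<open>E\<close> of the points of \<open>A \<inter> I\<close> that the
  powers \<open>d\<^sub>i\<close> carry into \<open>B\<close> has positive measure. As \<open>p\<close> is determined by the \<open>k\<^sub>i\<close> and \<open>d\<^sub>i\<close>, there is a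
  product of levels of a later column in which the complement of \<open>E\<close> has a relative measure below
  \<open>4\<^sup>-\<^sup>p\<^sup>r / 3\<close> (\<open>dense_subbox\<close>). Translating one small piece of this product to another by the powers
  \<open>k\<^sub>i n - d\<^sub>i\<close>, one finds a set of positive measure of points \<open>x \<in> E\<close> whose image \<open>y\<close> is also in \<open>E\<close>. The
  powers \<open>k\<^sub>i n\<close> take \<open>x \<in> A\<close> to the point that the powers \<open>d\<^sub>i\<close> make of \<open>y\<close>, which is in \<open>B\<close>. So the
  orbit of \<open>A\<close> meets \<open>B\<close> in positive measure (\<open>powers_not_separating\<close>), and \<open>A\<close> and its complement cannot
  both have positive measure when \<open>A\<close> is invariant.
\<close>

section \<open>Levels of the columns\<close>

text \<open>
  Pieces of different levels stay disjoint, pieces of one level are neighbours, and the spacers avoid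
  the old levels and one another by the choice of their positions.
\<close>

lemma disjoint_levels_cut_stack:
  assumes w: "w > 0" and bs: "sorted_wrt (\<lambda>a b. level w a \<inter> level w b = {}) bs"
    and v: "valid_spacers w bs ss s"
  shows "sorted_wrt (\<lambda>a b. level (w/4) a \<inter> level (w/4) b = {}) (cut_stack w bs ss s)"
proof -
  have dis: "level w a \<inter> level w b = {}" if ab: "a \<in> set bs" "b \<in> set bs" "a \<noteq> b" for a b
  proof -
    obtain i where i: "i < length bs" "a = bs ! i"
      using ab(1) by (auto simp: in_set_conv_nth)
    obtain j where j: "j < length bs" "b = bs ! j"
      using ab(2) by (auto simp: in_set_conv_nth)
    note ij = i j
    have "i < j \<or> j < i"
      using ab(3) ij by (metis nat_neq_iff)
    then show ?thesis
      using sorted_wrt_nth_less[OF bs, of i j] sorted_wrt_nth_less[OF bs, of j i] ij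
      by (metis Int_commute)
  qed
  have sub: "level (w/4) (a + real j * (w/4)) \<subseteq> level w a" if "j < 4" for a j
  proof -
    have "real j * (w/4) \<ge> 0" "real j * (w/4) \<le> 3 * (w/4)"
      using w that by (auto intro!: mult_right_mono)
    then show ?thesis
      unfolding level_def subset_iff atLeastLessThan_iff using w by (intro allI impI) linarith
  qed
  have cross: "level (w/4) (a + real i * (w/4)) \<inter> level (w/4) (b + real j * (w/4)) = {}"
    if "a \<in> set bs" "b \<in> set bs" "i < j" "j < 4" for a b i j
  proof (cases "a = b")
    case True
    have "(real i + 1) * (w/4) \<le> real j * (w/4)"
      using that w by (intro mult_right_mono) auto
    then show ?thesis
      using True by (auto simp: level_def algebra_simps)
  next
    case False
    then show ?thesis
      using dis[of a b] that sub[of i a] sub[of j b] by fastforce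
  qed
  have sp: "level (w/4) (a + real j * (w/4)) \<inter> level (w/4) t = {}"
    "level (w/4) t \<inter> level (w/4) (a + real j * (w/4)) = {}"
    if "a \<in> set bs" "t \<in> set (ss @ [s])" "j < 4" for a t j
    using v that sub[of j a] unfolding valid_spacers_def by blast+
  have sc: "sorted_wrt (\<lambda>a b. level (w/4) a \<inter> level (w/4) b = {}) (subcolumn w bs j)" if "j < 4" for j
    unfolding subcolumn_def sorted_wrt_map
    using bs by (rule sorted_wrt_mono_rel[rotated]) (use sub[OF that] in blast)
  have ss: "sorted_wrt (\<lambda>a b. level (w/4) a \<inter> level (w/4) b = {}) (ss @ [s])"
    using v unfolding valid_spacers_def sorted_wrt_iff_nth_less disjoint_family_on_def
    by (auto simp del: length_append)
  have st: "sorted_wrt (\<lambda>a b. level (w/4) a \<inter> level (w/4) b = {}) ss"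
    "\<forall>a\<in>set ss. level (w/4) a \<inter> level (w/4) s = {}"
    using ss by (auto simp: sorted_wrt_append)
  have cr: "\<forall>x\<in>set (subcolumn w bs i). \<forall>y\<in>set (subcolumn w bs j). level (w/4) x \<inter> level (w/4) y = {}"
    if "i < j" "j < 4" for i j
    using cross that by (auto simp: subcolumn_def)
  have sp': "\<forall>x\<in>set (subcolumn w bs i). \<forall>y\<in>set (ss @ [s]). level (w/4) x \<inter> level (w/4) y = {}
      \<and> level (w/4) y \<inter> level (w/4) x = {}" if "i < 4" for i
    using sp that by (auto simp: subcolumn_def)
  show ?thesis
    unfolding cut_stack_def sorted_wrt_append
    using sc[of 0] sc[of 1] sc[of 2] sc[of 3] st cr[of 0 1] cr[of 0 2] cr[of 0 3] cr[of 1 2] cr[of 1 3]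
      cr[of 2 3] sp'[of 0] sp'[of 1] sp'[of 2] sp'[of 3]
    by (simp add: ball_Un)
qed

locale columns =
  fixes C :: "nat \<Rightarrow> real list"
  assumes columns: "column_sequence C"
begin

abbreviation height :: "nat \<Rightarrow> nat" where "height k \<equiv> length (C k)"

definition lev :: "nat \<Rightarrow> nat \<Rightarrow> real set" where
  "lev k i = level (col_width k) (C k ! i)"

definition tower :: "nat \<Rightarrow> real set" where
  "tower k = (\<Union>i<height k. lev k i)"

lemma col_width_pos: "col_width k > 0"
  by (simp add: col_width_def)

lemma col_width_Suc: "k \<ge> 1 \<Longrightarrow> col_width (Suc k) = col_width k / 4"
  by (cases k) (auto simp: col_width_def)

lemma next_column:
  assumes "k \<ge> 1"
  obtains ss s where "valid_spacers (col_width k) (C k) ss s"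
    "C (Suc k) = cut_stack (col_width k) (C k) ss s"
  using columns assms unfolding column_sequence_def by blast

lemma height_1: "height 1 = 1"
  using columns by (simp add: column_sequence_def)

lemma height_Suc: "k \<ge> 1 \<Longrightarrow> height (Suc k) = 5 * height k + 1"
  by (erule next_column) (simp add: cut_stack_def subcolumn_def valid_spacers_def)

text \<open>
  The subcolumns 0, 1, 2, 3 start \<open>0, 1, 3, 4\<close> heights above the base of the next column, because the
  spacers on subcolumn 1 fill one more height. This maps the number of heights back to the subcolumn.
\<close>

definition cut_index :: "nat \<Rightarrow> nat" where
  "cut_index q = (if q \<ge> 3 then q - 1 else q)"

lemma nth_next_column:
  assumes "k \<ge> 1" "q \<in> {0, 1, 3, 4}" "i < height k"
  shows "C (Suc k) ! (i + q * height k) = C k ! i + real (cut_index q) * (col_width k / 4)"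
proof -
  obtain ss s where v: "valid_spacers (col_width k) (C k) ss s"
    and c: "C (Suc k) = cut_stack (col_width k) (C k) ss s"
    using next_column assms(1) by blast
  have ss: "length ss = height k"
    using v by (simp add: valid_spacers_def)
  define w where "w = col_width k / 4"
  define bs where "bs = C k"
  have sub: "subcolumn (col_width k) (C k) j ! i = bs ! i + real j * w"
    "length (subcolumn (col_width k) (C k) j) = length bs" for j
    using assms(3) by (simp_all add: subcolumn_def w_def bs_def)
  have i: "i < length bs" "length ss = length bs"
    using assms(3) ss by (simp_all add: bs_def)
  consider "q = 0" | "q = 1" | "q = 3" | "q = 4"
    using assms(2) by blast
  then show ?thesis
    unfolding c cut_stack_def w_def[symmetric] bs_def[symmetric]
    by cases (simp_all add: cut_index_def nth_append sub[folded bs_def] i)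
qed

lemma disjoint_levels_sorted:
  assumes "k \<ge> 1"
  shows "sorted_wrt (\<lambda>a b. level (col_width k) a \<inter> level (col_width k) b = {}) (C k)"
  using assms
proof (induction k rule: dec_induct)
  case base
  then show ?case using columns by (simp add: column_sequence_def)
next
  case (step n)
  obtain ss s where "valid_spacers (col_width n) (C n) ss s"
    "C (Suc n) = cut_stack (col_width n) (C n) ss s"
    using next_column step.hyps by blast
  then show ?case
    using disjoint_levels_cut_stack[OF col_width_pos step.IH] unfolding col_width_Suc[OF step.hyps(1)] by simp
qed

lemma lev_disjoint:
  assumes "k \<ge> 1" "i < height k" "j < height k" "x \<in> lev k i" "x \<in> lev k j"
  shows "i = j"
proof (rule ccontr)
  assume "i \<noteq> j"
  then consider "i < j" | "j < i" by linarith
  then show False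
    using disjoint_levels_sorted[OF assms(1)] assms(2-)
    unfolding sorted_wrt_iff_nth_less lev_def by cases blast+
qed

lemma Union_tower: "(\<Union>k\<in>{1..}. tower k) = {0..}"
proof -
  have "tower k = (\<Union>a\<in>set (C k). level (col_width k) a)" for k
    unfolding tower_def lev_def set_conv_nth by blast
  then show ?thesis
    using columns by (simp add: column_sequence_def)
qed

lemma lev_nonneg: "k \<ge> 1 \<Longrightarrow> i < height k \<Longrightarrow> lev k i \<subseteq> {0..}"
  using Union_tower unfolding tower_def by fastforce

lemma lev_next_subset:
  assumes "k \<ge> 1" "q \<in> {0, 1, 3, 4}" "i < height k"
  shows "lev (Suc k) (i + q * height k) \<subseteq> lev k i"
proof -
  have "0 \<le> real (cut_index q) * (col_width k / 4)" "real (cut_index q) * (col_width k / 4) \<le> 3 * (col_width k / 4)"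
    using assms(2) col_width_pos[of k] by (auto simp: cut_index_def)
  then show ?thesis
    using nth_next_column[OF assms] col_width_Suc[OF assms(1)] by (auto simp: lev_def level_def)
qed

lemma lev_next_cover:
  assumes "k \<ge> 1" "i < height k" "x \<in> lev k i"
  obtains q where "q \<in> {0, 1, 3, 4}" "x \<in> lev (Suc k) (i + q * height k)"
proof -
  have "\<exists>q\<in>{0,1,3,4}. x \<in> lev (Suc k) (i + q * height k)"
  proof -
    note n = nth_next_column[OF assms(1) _ assms(2)]
    from assms(3) show ?thesis
      unfolding lev_def level_split4[OF col_width_pos] col_width_Suc[OF assms(1)]
      using n[of 0] n[of 1] n[of 3] n[of 4] by (auto simp: cut_index_def)
  qed
  then show ?thesis using that by blast
qed

section \<open>Powers of the transformation act as translations inside a column\<close>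

text \<open>
  The relation "\<open>y\<close> lies \<open>z\<close> levels above \<open>x\<close> in column \<open>k\<close>". It is the graph of a partial translation
  for positive and negative \<open>z\<close> alike, and it only grows with \<open>k\<close>; all facts about the transformation,
  its inverse and their powers are derived from it.
\<close>

definition shift :: "nat \<Rightarrow> int \<Rightarrow> real \<Rightarrow> real \<Rightarrow> bool" where
  "shift k z x y \<longleftrightarrow> (\<exists>i j. i < height k \<and> j < height k \<and> int j = int i + z \<and>
     x \<in> lev k i \<and> y = x + (C k ! j - C k ! i))"

lemma shift_lev:
  assumes "x \<in> lev k i" "i < height k" "j < height k" "int j = int i + z"
  shows "shift k z x (x + (C k ! j - C k ! i))"
  using assms unfolding shift_def by blast

lemma lev_translate: "x \<in> lev k i \<Longrightarrow> x + (C k ! j - C k ! i) \<in> lev k j"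
  by (auto simp: lev_def level_def)

text \<open>
  All four pieces of level \<open>i\<close> are displaced in the same way relative to the pieces of level \<open>j\<close>: the
  next column contains translated copies of the column.
\<close>

lemma shift_Suc:
  assumes "k \<ge> 1" "shift k z x y"
  shows "shift (Suc k) z x y"
proof -
  obtain i j where ij: "i < height k" "j < height k" "int j = int i + z" "x \<in> lev k i"
    "y = x + (C k ! j - C k ! i)"
    using assms(2) unfolding shift_def by blast
  obtain q where q: "q \<in> {0, 1, 3, 4}" "x \<in> lev (Suc k) (i + q * height k)"
    using lev_next_cover[OF assms(1) ij(1,4)] .
  have "q * height k \<le> 4 * height k"
    using q(1) by auto
  then have "i + q * height k < height (Suc k)" "j + q * height k < height (Suc k)"
    using ij(1,2) height_Suc[OF assms(1)] by linarith+
  then show ?thesis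
    using shift_lev[OF q(2), of "j + q * height k" z] ij
    using nth_next_column[OF assms(1) q(1) ij(1)] nth_next_column[OF assms(1) q(1) ij(2)] by simp
qed

lemma shift_mono: "k \<le> l \<Longrightarrow> 1 \<le> k \<Longrightarrow> shift k z x y \<Longrightarrow> shift l z x y"
  by (induction l rule: dec_induct) (auto intro: shift_Suc)

lemma shift_unique_aux:
  assumes "k \<ge> 1" "shift k z x y" "shift k z x y'"
  shows "y = y'"
  using assms lev_disjoint unfolding shift_def by (smt (verit) of_nat_eq_iff)

lemma shift_unique:
  assumes "k \<ge> 1" "l \<ge> 1" "shift k z x y" "shift l z x y'"
  shows "y = y'"
  using shift_unique_aux[of "max k l" z x y y'] shift_mono[of k "max k l"] shift_mono[of l "max k l"] assms
  by simp

lemma shift_sym: "shift k z x y \<Longrightarrow> shift k (- z) y x"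
  unfolding shift_def using lev_translate by fastforce

lemma shift_nonneg: "k \<ge> 1 \<Longrightarrow> shift k z x y \<Longrightarrow> x \<ge> 0 \<and> y \<ge> 0"
  using lev_nonneg shift_sym unfolding shift_def by (metis atLeast_iff lev_translate subsetD)

abbreviation T :: "real \<Rightarrow> real" where "T \<equiv> cs_map C"

abbreviation T_inv :: "real \<Rightarrow> real" where "T_inv \<equiv> inverse_on {0..} T"

lemma T_eq:
  assumes "k \<ge> 1" "shift k 1 x y"
  shows "T x = y"
proof -
  have "(\<exists>k\<ge>1. \<exists>i. Suc i < length (C k) \<and> x \<in> level (col_width k) (C k ! i) \<and>
      y = x + (C k ! Suc i - C k ! i)) \<longleftrightarrow> (\<exists>k\<ge>1. shift k 1 x y)" for y
    unfolding shift_def lev_def by (metis Suc_lessD of_nat_Suc of_nat_eq_iff add.commute)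
  then show ?thesis
    unfolding cs_map_def using assms shift_unique by (intro the_equality) auto
qed

text \<open>
  A point of a column is below the top of the next column, since the top level there is a spacer.
\<close>

lemma T_shift:
  assumes "x \<ge> 0"
  obtains k where "k \<ge> 1" "shift k 1 x (T x)"
proof -
  obtain k i where k: "k \<ge> 1" and i: "i < height k" "x \<in> lev k i"
    using assms Union_tower unfolding tower_def by (metis (no_types, lifting) UN_iff atLeast_iff lessThan_iff)
  obtain q where q: "q \<in> {0, 1, 3, 4}" "x \<in> lev (Suc k) (i + q * height k)"
    using lev_next_cover[OF k i] .
  have "q * height k \<le> 4 * height k"
    using q(1) by auto
  then have "Suc (i + q * height k) < height (Suc k)"
    using i(1) height_Suc[OF k] by linarith
  then have "shift (Suc k) 1 x (x + (C (Suc k) ! Suc (i + q * height k) - C (Suc k) ! (i + q * height k)))"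
    by (intro shift_lev[OF q(2)]) auto
  then show ?thesis
    using T_eq that by (metis le_add1 plus_1_eq_Suc)
qed

lemma T_nonneg: "x \<ge> 0 \<Longrightarrow> T x \<ge> 0"
  using T_shift shift_nonneg by metis

lemma inj_T: "inj_on T {0..}"
proof (rule inj_onI)
  fix x x' assume "x \<in> {0..}" "x' \<in> {0..}" and eq: "T x = T x'"
  then obtain k l where kl: "k \<ge> 1" "shift k 1 x (T x)" "l \<ge> 1" "shift l 1 x' (T x')"
    using T_shift by (metis atLeast_iff)
  then show "x = x'"
    using shift_unique[of k l "-1" "T x" x x'] shift_sym eq by metis
qed

lemma T_inv_T: "x \<ge> 0 \<Longrightarrow> T_inv (T x) = x"
  using inj_T by (simp add: inverse_on_def)

lemma T_T_inv: "y \<in> T ` {0..} \<Longrightarrow> T (T_inv y) = y"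
  by (simp add: inverse_on_def f_inv_into_f)

lemma T_inv_nonneg: "y \<ge> 0 \<Longrightarrow> T_inv y \<ge> 0"
  using inv_into_into[of y T "{0..}"] by (auto simp: inverse_on_def)

lemma T_inv_eq: "k \<ge> 1 \<Longrightarrow> shift k (-1) x y \<Longrightarrow> T_inv x = y"
  using T_eq[of k y x] T_inv_T[of y] shift_sym[of k "-1" x y] shift_nonneg by fastforce

lemma shift_split:
  assumes k: "k \<ge> 1" and s: "shift k (z + z') x y" and z: "z \<ge> 0 \<and> z' \<ge> 0 \<or> z \<le> 0 \<and> z' \<le> 0"
  obtains u where "shift k z x u" "shift k z' u y"
proof -
  obtain i j where ij: "i < height k" "j < height k" "int j = int i + (z + z')" "x \<in> lev k i"
    "y = x + (C k ! j - C k ! i)"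
    using s unfolding shift_def by blast
  define l where "l = nat (int i + z)"
  have l: "int l = int i + z" "l < height k"
    using z ij(1-3) unfolding l_def by linarith+
  have "shift k z x (x + (C k ! l - C k ! i))"
    using shift_lev[OF ij(4,1)] l by blast
  moreover have "shift k z' (x + (C k ! l - C k ! i)) y"
    using shift_lev[OF lev_translate[OF ij(4)] l(2) ij(2), where z = z'] l ij by simp
  ultimately show ?thesis using that by blast
qed

lemma T_funpow_eq: "k \<ge> 1 \<Longrightarrow> shift k (int n) x y \<Longrightarrow> (T ^^ n) x = y"
proof (induction n arbitrary: y)
  case 0
  then show ?case unfolding shift_def by auto
next
  case (Suc n)
  obtain u where "shift k (int n) x u" "shift k 1 u y"
    using shift_split[of k "int n" 1 x y] Suc.prems by (auto simp: add.commute)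
  then show ?case using Suc T_eq by auto
qed

lemma T_inv_funpow_eq: "k \<ge> 1 \<Longrightarrow> shift k (- int n) x y \<Longrightarrow> (T_inv ^^ n) x = y"
proof (induction n arbitrary: y)
  case 0
  then show ?case unfolding shift_def by auto
next
  case (Suc n)
  obtain u where "shift k (- int n) x u" "shift k (-1) u y"
    using shift_split[of k "- int n" "-1" x y] Suc.prems by (auto simp: add.commute)
  then show ?case using Suc T_inv_eq by auto
qed

abbreviation T_power :: "int \<Rightarrow> real \<Rightarrow> real" where
  "T_power \<equiv> int_power_on {0..} T"

lemma T_power_eq: "k \<ge> 1 \<Longrightarrow> shift k z x y \<Longrightarrow> T_power z x = y"
  using T_funpow_eq[of k "nat z" x y] T_inv_funpow_eq[of k "nat (-z)" x y]
  by (auto simp: int_power_on_def)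

lemma T_power_lev:
  assumes "k \<ge> 1" "x \<in> lev k i" "i < height k" "j < height k" "int j = int i + z"
  shows "T_power z x = x + (C k ! j - C k ! i)" "T_power z x \<in> lev k j"
  using T_power_eq[OF assms(1) shift_lev[OF assms(2-5)]] lev_translate[OF assms(2)] by auto

lemma T_power_mult: "T_power z ^^ n = T_power (z * int n)"
proof (cases "z \<ge> 0")
  case True
  then have "nat (z * int n) = nat z * n" "0 \<le> z * int n"
    by (simp_all add: nat_mult_distrib)
  with True show ?thesis
    by (simp add: int_power_on_def funpow_mult)
next
  case False
  then have z: "nat (- (z * int n)) = nat (- z) * n"
    using nat_mult_distrib[of "- z" "int n"] by simp
  show ?thesis
  proof (cases "n = 0")
    case True
    then show ?thesis by (simp add: int_power_on_def)
  next
    case n: False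
    then have "\<not> 0 \<le> z * int n"
      using False by (simp add: zero_le_mult_iff)
    with False z show ?thesis
      by (simp add: int_power_on_def funpow_mult)
  qed
qed

end

section \<open>Measure preserving maps and their products\<close>

lemma sets_half_line: "A \<in> sets half_line \<longleftrightarrow> A \<subseteq> {0..} \<and> A \<in> sets lebesgue"
proof -
  have "{0::real..} \<in> sets borel" by simp
  then have "{0::real..} \<inter> space lebesgue \<in> sets lebesgue" by simp
  from sets_restrict_space_iff[OF this, of A] show ?thesis
    unfolding half_line_def .
qed

lemma space_half_line [simp]: "space half_line = {0..}"
  by (simp add: half_line_def)

lemma emeasure_half_line: "A \<in> sets half_line \<Longrightarrow> emeasure half_line A = emeasure lebesgue A"
  using sets_half_line[of A] emeasure_restrict_space[of "{0..}" lebesgue A] by (simp add: half_line_def)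

lemma emeasure_lebesgue_translate:
  fixes A :: "real set"
  shows "emeasure lebesgue ((+) c ` A) = emeasure lebesgue A"
  using emeasure_lebesgue_affine[of 1 c A] by (simp add: add.commute[of c])

lemma emeasure_half_line_level:
  "level w a \<subseteq> {0..} \<Longrightarrow> 0 \<le> w \<Longrightarrow> emeasure half_line (level w a) = ennreal w"
  by (subst emeasure_half_line) (auto simp: sets_half_line level_def)

lemma measure_preserving_map_compose:
  assumes "measure_preserving_map M f" "measure_preserving_map M g"
  shows "measure_preserving_map M (f \<circ> g)"
  unfolding measure_preserving_map_def
proof (intro conjI ballI)
  have f: "f \<in> measurable M M" and g: "g \<in> measurable M M"
    using assms by (auto simp: measure_preserving_map_def)
  show "f \<circ> g \<in> measurable M M"
    using g f by (rule measurable_comp)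
  fix A assume A: "A \<in> sets M"
  have "(f \<circ> g) -` A \<inter> space M = g -` (f -` A \<inter> space M) \<inter> space M"
    using measurable_space[OF g] by auto
  then show "emeasure M ((f \<circ> g) -` A \<inter> space M) = emeasure M A"
    using assms A measurable_sets[OF f A] by (simp only: measure_preserving_map_def)
qed

lemma measure_preserving_map_funpow:
  assumes "measure_preserving_map M f"
  shows "measure_preserving_map M (f ^^ n)"
proof (induction n)
  case 0
  have "A \<in> sets M \<Longrightarrow> (\<lambda>x. x) -` A \<inter> space M = A" for A
    using sets.sets_into_space by fastforce
  then show ?case by (simp add: measure_preserving_map_def id_def)
next
  case (Suc n)
  then show ?case using measure_preserving_map_compose[OF assms] by (simp add: comp_def)
qed

lemma measure_preserving_map_null:
  assumes "measure_preserving_map M f" "N \<in> null_sets M"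
  shows "f -` N \<inter> space M \<in> null_sets M"
  using assms by (auto simp: measure_preserving_map_def null_sets_def measurable_sets)

text \<open>
  Preimages of null sets are null, which handles the sets that the completion adds.
\<close>

lemma measure_preserving_map_completion:
  assumes "measure_preserving_map M f"
  shows "measure_preserving_map (completion M) f"
proof -
  have f: "f \<in> measurable M M" and d: "distr M M f = M"
    using assms by (auto simp: measure_preserving_map_def emeasure_distr intro!: measure_eqI)
  have f': "f \<in> measurable (completion M) M"
    using f by (rule measurable_completion)
  have d': "distr (completion M) M f = M"
    using distr_completion[OF f] d by simp
  have m: "f \<in> measurable (completion M) (completion M)"
    using f' d' by (intro completion.measurable_completion2) auto
  have "completion M = distr (completion M) (completion M) f"
    using completion.completion_distr_eq[OF f'] d' by simp
  then show ?thesis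
    using m emeasure_distr[OF m] by (simp add: measure_preserving_map_def)
qed

text \<open>
  A product measure is determined by its values on rectangles, whose preimages are rectangles.
\<close>

lemma measure_preserving_map_product:
  assumes sf: "sigma_finite_measure M"
    and f: "\<And>i. i < r \<Longrightarrow> measure_preserving_map M (f i)"
  shows "measure_preserving_map (\<Pi>\<^sub>M i\<in>{..<r}. M) (product_map r f)"
proof -
  interpret product_sigma_finite "\<lambda>_. M" using sf by (simp add: product_sigma_finite_def)
  have fm: "f i \<in> measurable M M" if "i < r" for i
    using f[OF that] by (simp add: measure_preserving_map_def)
  let ?P = "\<Pi>\<^sub>M i\<in>{..<r}. M"
  have m: "product_map r f \<in> measurable ?P ?P"
    unfolding product_map_def
    by (intro measurable_restrict measurable_compose[OF measurable_component_singleton]) (auto intro: fm)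
  have "distr ?P ?P (product_map r f) = ?P"
  proof (intro PiM_eqI)
    fix A assume A: "\<And>i. i \<in> {..<r} \<Longrightarrow> A i \<in> sets M"
    have eq: "product_map r f -` (Pi\<^sub>E {..<r} A) \<inter> space ?P = Pi\<^sub>E {..<r} (\<lambda>i. f i -` A i \<inter> space M)"
      by (auto simp: product_map_def space_PiM PiE_iff)
    have B: "i \<in> {..<r} \<Longrightarrow> f i -` A i \<inter> space M \<in> sets M" for i
      using A measurable_sets[OF fm] by auto
    have "emeasure (distr ?P ?P (product_map r f)) (Pi\<^sub>E {..<r} A) = emeasure ?P (product_map r f -` (Pi\<^sub>E {..<r} A) \<inter> space ?P)"
      using A by (intro emeasure_distr[OF m] sets_PiM_I_finite) auto
    also have "\<dots> = (\<Prod>i<r. emeasure M (f i -` A i \<inter> space M))"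
      unfolding eq using B by (rule emeasure_PiM[OF finite_lessThan])
    also have "\<dots> = (\<Prod>i<r. emeasure M (A i))"
    proof (rule prod.cong[OF refl])
      fix i assume "i \<in> {..<r}"
      then show "emeasure M (f i -` A i \<inter> space M) = emeasure M (A i)"
        using f[of i] A[of i] by (simp only: measure_preserving_map_def lessThan_iff)
    qed
    finally show "emeasure (distr ?P ?P (product_map r f)) (Pi\<^sub>E {..<r} A) = (\<Prod>i\<in>{..<r}. emeasure M (A i))" .
  qed auto
  then have "emeasure ?P (product_map r f -` A \<inter> space ?P) = emeasure ?P A" if "A \<in> sets ?P" for A
    using emeasure_distr[OF m that] by (simp only:)
  then show ?thesis
    using m unfolding measure_preserving_map_def by blast
qed

lemma zero_null: "{0} \<in> null_sets half_line"
proof -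
  have "{0::real} \<in> sets half_line" by (simp add: sets_half_line)
  then show ?thesis by (simp add: null_sets_def emeasure_half_line)
qed

lemma sigma_finite_half_line: "sigma_finite_measure half_line"
proof
  have "{0..real n} \<in> sets half_line" for n
    by (auto simp: sets_half_line)
  moreover have "(\<Union>n. {0..real n}) = {0..}"
    using real_arch_simple by fastforce
  ultimately show "\<exists>A. countable A \<and> A \<subseteq> sets half_line \<and> \<Union>A = space half_line \<and>
      (\<forall>a\<in>A. emeasure half_line a \<noteq> \<infinity>)"
    by (intro exI[of _ "range (\<lambda>n. {0..real n})"]) (auto simp: emeasure_half_line)
qed

section \<open>The transformation preserves Lebesgue measure\<close>

context columns
begin

lemma lev_sets: "k \<ge> 1 \<Longrightarrow> i < height k \<Longrightarrow> lev k i \<in> sets half_line"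
  using lev_nonneg by (auto simp: sets_half_line lev_def level_def)

lemma tower_Suc_subset: "k \<ge> 1 \<Longrightarrow> tower k \<subseteq> tower (Suc k)"
proof
  fix x assume k: "k \<ge> 1" "x \<in> tower k"
  then obtain i where i: "i < height k" "x \<in> lev k i"
    by (auto simp: tower_def)
  obtain q where q: "q \<in> {0, 1, 3, 4}" "x \<in> lev (Suc k) (i + q * height k)"
    using lev_next_cover[OF k(1) i] .
  have "q * height k \<le> 4 * height k"
    using q(1) by auto
  then show "x \<in> tower (Suc k)"
    using q(2) i(1) height_Suc[OF k(1)] unfolding tower_def
    by (intro UN_I[of "i + q * height k"] iffD2[OF lessThan_iff]) linarith+
qed

lemma tower_mono: "k \<le> l \<Longrightarrow> 1 \<le> k \<Longrightarrow> tower k \<subseteq> tower l"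
proof (induction l rule: dec_induct)
  case (step n)
  then show ?case using tower_Suc_subset[of n] by fastforce
qed auto

lemma tower_exists: "x \<ge> 0 \<Longrightarrow> \<exists>k\<ge>1. x \<in> tower k"
  using Union_tower by (metis UN_iff atLeast_iff)

lemma height_pos: "k \<ge> 1 \<Longrightarrow> height k > 0"
  by (induction k rule: dec_induct) (auto simp: height_1[simplified] height_Suc)

lemma nth_0_eq: "k \<ge> 1 \<Longrightarrow> C k ! 0 = 0"
proof (induction k rule: dec_induct)
  case base
  then show ?case using columns by (simp add: column_sequence_def)
next
  case (step n)
  then show ?case using nth_next_column[of n 0 0] height_pos by (auto simp: cut_index_def)
qed

lemma T_vimage_lev:
  assumes "k \<ge> 1" "Suc i < height k"
  shows "T -` A \<inter> lev k i = (+) (C k ! i - C k ! Suc i) ` (A \<inter> lev k (Suc i))"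
proof -
  have "x \<in> T -` A \<inter> lev k i \<longleftrightarrow> x \<in> lev k i \<and> x + (C k ! Suc i - C k ! i) \<in> A" for x
    using T_eq[OF assms(1) shift_lev[of x k i "Suc i" 1]] assms by auto
  moreover have "x \<in> (+) (C k ! i - C k ! Suc i) ` (A \<inter> lev k (Suc i)) \<longleftrightarrow>
      x + (C k ! Suc i - C k ! i) \<in> A \<inter> lev k (Suc i)" for x
    by (auto simp: image_iff algebra_simps intro!: bexI[of _ "x + (C k ! Suc i - C k ! i)"])
  moreover have "x + (C k ! Suc i - C k ! i) \<in> lev k (Suc i) \<longleftrightarrow> x \<in> lev k i" for x
    by (auto simp: lev_def level_def)
  ultimately show ?thesis by blast
qed

text \<open>
  The domain and the range of the transformation as far as it is defined by column \<open>k\<close>.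
\<close>

definition below_top :: "nat \<Rightarrow> real set" where
  "below_top k = (\<Union>i<height k - 1. lev k i)"

definition above_base :: "nat \<Rightarrow> real set" where
  "above_base k = (\<Union>i<height k - 1. lev k (Suc i))"

lemma below_top_iff: "k \<ge> 1 \<Longrightarrow> x \<in> below_top k \<longleftrightarrow> shift k 1 x (T x)"
proof
  assume k: "k \<ge> 1" and "x \<in> below_top k"
  then obtain i where "Suc i < height k" "x \<in> lev k i"
    by (auto simp: below_top_def less_diff_conv)
  then show "shift k 1 x (T x)"
    using shift_lev[of x k i "Suc i" 1] T_eq[OF k] by fastforce
next
  assume "k \<ge> 1" "shift k 1 x (T x)"
  then obtain i j where "j < height k" "int j = int i + 1" "x \<in> lev k i"
    unfolding shift_def by blast
  then show "x \<in> below_top k"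
    unfolding below_top_def by (intro UN_I[of i]) auto
qed

lemma above_base_iff: "k \<ge> 1 \<Longrightarrow> x \<in> above_base k \<longleftrightarrow> shift k (-1) x (T_inv x)"
proof
  assume k: "k \<ge> 1" and "x \<in> above_base k"
  then obtain i where "Suc i < height k" "x \<in> lev k (Suc i)"
    by (auto simp: above_base_def less_diff_conv)
  then show "shift k (-1) x (T_inv x)"
    using shift_lev[of x k "Suc i" i "-1"] T_inv_eq[OF k] by fastforce
next
  assume "k \<ge> 1" "shift k (-1) x (T_inv x)"
  then obtain i j where ij: "i < height k" "int j = int i + -1" "x \<in> lev k i"
    unfolding shift_def by blast
  then have "i = Suc j" by linarith
  with ij have "j < height k - 1" "x \<in> lev k (Suc j)" by auto
  then show "x \<in> above_base k"
    unfolding above_base_def by blast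
qed

lemma incseq_below_top: "incseq (\<lambda>n. below_top (Suc n))"
  by (intro incseq_SucI subsetI) (use shift_Suc in \<open>auto simp: below_top_iff\<close>)

lemma incseq_above_base: "incseq (\<lambda>n. above_base (Suc n))"
  by (intro incseq_SucI subsetI) (use shift_Suc in \<open>auto simp: above_base_iff\<close>)

lemma Union_below_top: "(\<Union>n. below_top (Suc n)) = {0..}"
proof (intro equalityI subsetI)
  fix x assume "x \<in> (\<Union>n. below_top (Suc n))"
  then show "x \<in> {0..}"
    using shift_nonneg[of "Suc n" for n] by (auto simp: below_top_iff)
next
  fix x :: real assume "x \<in> {0..}"
  then obtain k where "k \<ge> 1" "shift k 1 x (T x)"
    using T_shift by (metis atLeast_iff)
  then show "x \<in> (\<Union>n. below_top (Suc n))"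
    using below_top_iff by (intro UN_I[of "k - 1"]) auto
qed

lemma Union_above_base: "(\<Union>n. above_base (Suc n)) = {0<..}"
proof (intro equalityI subsetI)
  fix x assume "x \<in> (\<Union>n. above_base (Suc n))"
  then obtain n i where n: "Suc i < height (Suc n)" "x \<in> lev (Suc n) (Suc i)"
    by (auto simp: above_base_def less_diff_conv)
  have "0 \<in> lev (Suc n) 0"
    using nth_0_eq[of "Suc n"] col_width_pos[of "Suc n"] by (auto simp: lev_def level_def)
  then have "x \<noteq> 0"
    using lev_disjoint[of "Suc n" 0 "Suc i" 0] n by fastforce
  moreover have "x \<ge> 0"
    using lev_nonneg n by fastforce
  ultimately show "x \<in> {0<..}" by simp
next
  fix x :: real assume x: "x \<in> {0<..}"
  then obtain k where k: "k \<ge> 1" "x \<in> tower k"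
    using tower_exists by (metis greaterThan_iff less_imp_le)
  obtain n where n: "(1/4) ^ n < x"
    using x real_arch_pow_inv[of x "1/4"] by auto
  define l where "l = max k (Suc n)"
  have l: "l \<ge> 1" "x \<in> tower l"
    using k tower_mono[of k l] by (auto simp: l_def)
  then obtain i where i: "i < height l" "x \<in> lev l i"
    by (auto simp: tower_def)
  have "(1/4::real) ^ (l - 1) \<le> (1/4) ^ n"
    by (intro power_decreasing) (auto simp: l_def)
  then have "col_width l < x"
    using n by (simp add: col_width_def power_one_over)
  then have "i \<noteq> 0"
    using i(2) nth_0_eq[OF l(1)] by (intro notI) (simp add: lev_def level_def)
  then have "x \<in> above_base l"
    using i unfolding above_base_def by (intro UN_I[of "i - 1"]) auto
  then show "x \<in> (\<Union>n. above_base (Suc n))"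
    using l(1) by (intro UN_I[of "l - 1"]) auto
qed

text \<open>
  Level by level, the transformation is a translation of the levels below the top to the levels above
  the base.
\<close>

lemma T_vimage_below_top:
  assumes k: "k \<ge> 1" and A: "A \<in> sets half_line"
  shows "T -` A \<inter> below_top k \<in> sets half_line"
    and "emeasure half_line (T -` A \<inter> below_top k) = emeasure half_line (A \<inter> above_base k)"
proof -
  let ?I = "{..<height k - 1}"
  have lev: "lev k i \<in> sets half_line" "lev k (Suc i) \<in> sets half_line" if "i \<in> ?I" for i
    using lev_sets[OF k] that by auto
  have piece: "T -` A \<inter> lev k i = (+) (C k ! i - C k ! Suc i) ` (A \<inter> lev k (Suc i))" if "i \<in> ?I" for i
    using T_vimage_lev[OF k] that by auto
  have sets: "T -` A \<inter> lev k i \<in> sets half_line" if "i \<in> ?I" for i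
  proof -
    have "A \<inter> lev k (Suc i) \<in> sets lebesgue"
      using lev[OF that] A by (auto simp: sets_half_line)
    then have "T -` A \<inter> lev k i \<in> sets lebesgue"
      unfolding piece[OF that] by (rule lebesgue_sets_translation)
    moreover have "T -` A \<inter> lev k i \<subseteq> {0..}"
      using lev[OF that] by (auto simp: sets_half_line)
    ultimately show ?thesis by (simp add: sets_half_line)
  qed
  have U: "T -` A \<inter> below_top k = (\<Union>i\<in>?I. T -` A \<inter> lev k i)" "A \<inter> above_base k = (\<Union>i\<in>?I. A \<inter> lev k (Suc i))"
    by (auto simp: below_top_def above_base_def)
  show "T -` A \<inter> below_top k \<in> sets half_line"
    unfolding U using sets by (intro sets.finite_UN) auto
  have "emeasure half_line (T -` A \<inter> below_top k) = (\<Sum>i\<in>?I. emeasure half_line (T -` A \<inter> lev k i))"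
    unfolding U using sets lev_disjoint[OF k]
    by (intro sum_emeasure[symmetric]) (auto simp: disjoint_family_on_def)
  also have "\<dots> = (\<Sum>i\<in>?I. emeasure half_line (A \<inter> lev k (Suc i)))"
  proof (intro sum.cong refl)
    fix i assume i: "i \<in> ?I"
    have "emeasure half_line (T -` A \<inter> lev k i) = emeasure lebesgue (T -` A \<inter> lev k i)"
      using sets[OF i] by (rule emeasure_half_line)
    also have "\<dots> = emeasure half_line (A \<inter> lev k (Suc i))"
      using lev[OF i] A unfolding piece[OF i] emeasure_lebesgue_translate
      by (intro emeasure_half_line[symmetric]) auto
    finally show "emeasure half_line (T -` A \<inter> lev k i) = emeasure half_line (A \<inter> lev k (Suc i))" .
  qed
  also have "\<dots> = emeasure half_line (A \<inter> above_base k)"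
    unfolding U using lev A lev_disjoint[OF k, of "Suc i" "Suc j" for i j]
    by (intro sum_emeasure) (fastforce simp: disjoint_family_on_def)+
  finally show "emeasure half_line (T -` A \<inter> below_top k) = emeasure half_line (A \<inter> above_base k)" .
qed

text \<open>
  The parts of the preimage below the tops increase to the whole preimage, and the parts of \<open>A\<close> above
  the bases increase to \<open>A - {0}\<close>; so the equality of their measures survives in the limit.
\<close>

lemma measure_preserving_T: "measure_preserving_map half_line T"
proof -
  have vim: "T -` A \<inter> {0..} = (\<Union>n. T -` A \<inter> below_top (Suc n))" for A
    using Union_below_top by auto
  have m: "T \<in> measurable half_line half_line"
  proof (rule measurableI)
    fix A assume "A \<in> sets half_line"
    then show "T -` A \<inter> space half_line \<in> sets half_line"
      unfolding space_half_line vim using T_vimage_below_top(1) by (intro sets.countable_UN) auto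
  qed (use T_nonneg in auto)
  have "emeasure half_line (T -` A \<inter> {0..}) = emeasure half_line A" if A: "A \<in> sets half_line" for A
  proof -
    have inc: "incseq (\<lambda>n. T -` A \<inter> below_top (Suc n))" "incseq (\<lambda>n. A \<inter> above_base (Suc n))"
      using incseq_below_top incseq_above_base unfolding incseq_def by blast+
    have ab: "A \<inter> above_base (Suc n) \<in> sets half_line" for n
      unfolding above_base_def using A lev_sets[of "Suc n"] by (intro sets.Int sets.finite_UN) auto
    have A0: "A - {0} = (\<Union>n. A \<inter> above_base (Suc n))"
      using Union_above_base A by (auto simp: sets_half_line)
    have "emeasure half_line (T -` A \<inter> {0..}) = (SUP n. emeasure half_line (T -` A \<inter> below_top (Suc n)))"
      unfolding vim using T_vimage_below_top(1)[OF _ A] inc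
      by (intro SUP_emeasure_incseq[symmetric]) auto
    also have "\<dots> = (SUP n. emeasure half_line (A \<inter> above_base (Suc n)))"
      using T_vimage_below_top(2)[OF _ A] by simp
    also have "\<dots> = emeasure half_line (A - {0})"
      unfolding A0 using ab inc by (intro SUP_emeasure_incseq) auto
    also have "\<dots> = emeasure half_line A"
      using zero_null A by (rule emeasure_Diff_null_set)
    finally show ?thesis .
  qed
  with m show ?thesis by (simp add: measure_preserving_map_def)
qed

lemma T_image: "T ` {0..} \<supseteq> {0<..}"
proof
  fix y :: real assume "y \<in> {0<..}"
  then obtain n i where n: "Suc i < height (Suc n)" "y \<in> lev (Suc n) (Suc i)"
    unfolding Union_above_base[symmetric] by (auto simp: above_base_def less_diff_conv)
  define x where "x = y + (C (Suc n) ! i - C (Suc n) ! Suc i)"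
  have "shift (Suc n) (-1) y x"
    unfolding x_def using n by (intro shift_lev) auto
  then have "shift (Suc n) 1 x y"
    using shift_sym by fastforce
  then have "T x = y" "x \<ge> 0"
    using T_eq[of "Suc n" x y] shift_nonneg[of "Suc n" 1 x y] by auto
  then show "y \<in> T ` {0..}" by auto
qed

lemma T_inv_vimage:
  assumes "A \<subseteq> {0..}"
  shows "sym_diff (T_inv -` A \<inter> {0..}) (T ` A) \<subseteq> {0}"
proof -
  have "T_inv y \<in> A \<longleftrightarrow> y \<in> T ` A" if "y > 0" for y
  proof -
    have "y \<in> T ` {0..}" using T_image that by auto
    then obtain x where "x \<ge> 0" "y = T x" by auto
    then show ?thesis using T_inv_T inj_T assms by (auto simp: inj_on_def)
  qed
  moreover have "T ` A \<subseteq> {0..}" using T_nonneg assms by auto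
  ultimately show ?thesis using assms by (auto simp: image_subset_iff) (metis atLeast_iff linorder_less_linear not_less)+
qed

text \<open>
  Measurability of images is what the inverse needs. An image is a countable union of translated pieces;
  by injectivity its preimage is the original set, so the measure is preserved as well.
\<close>

lemma T_image_sets:
  assumes A: "A \<in> sets half_line"
  shows "T ` A \<in> sets half_line" "emeasure half_line (T ` A) = emeasure half_line A"
proof -
  have vim: "T -` (T ` A) \<inter> {0..} = A"
    using A inj_T by (auto simp: sets_half_line inj_on_def subset_iff)
  have "A = (\<Union>n. A \<inter> below_top (Suc n))"
    using Union_below_top A by (simp add: sets_half_line flip: Int_UN_distrib) blast
  then have "T ` A = T ` (\<Union>n. A \<inter> below_top (Suc n))"
    by (rule arg_cong)
  then have "T ` A = (\<Union>n. \<Union>i<height (Suc n) - 1. T ` (A \<inter> lev (Suc n) i))"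
    unfolding below_top_def Int_UN_distrib image_UN .
  also have "\<dots> \<in> sets half_line"
  proof (intro sets.countable_UN sets.finite_UN image_subsetI)
    fix n i assume i: "i \<in> {..<height (Suc n) - 1}"
    have "T ` (A \<inter> lev (Suc n) i) = (+) (C (Suc n) ! Suc i - C (Suc n) ! i) ` (A \<inter> lev (Suc n) i)"
    proof (intro image_cong refl)
      fix x assume "x \<in> A \<inter> lev (Suc n) i"
      then show "T x = C (Suc n) ! Suc i - C (Suc n) ! i + x"
        using i T_eq[OF _ shift_lev[of x "Suc n" i "Suc i" 1]] by auto
    qed
    moreover have "A \<inter> lev (Suc n) i \<in> sets lebesgue"
      using A lev_sets[of "Suc n" i] i by (auto simp: sets_half_line)
    ultimately have "T ` (A \<inter> lev (Suc n) i) \<in> sets lebesgue"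
      by (simp add: lebesgue_sets_translation)
    then show "T ` (A \<inter> lev (Suc n) i) \<in> sets half_line"
      using A T_nonneg by (auto simp: sets_half_line)
  qed
  finally show s: "T ` A \<in> sets half_line" .
  show "emeasure half_line (T ` A) = emeasure half_line A"
    using measure_preserving_T s vim by (simp add: measure_preserving_map_def) metis
qed

lemma measure_preserving_T_inv: "measure_preserving_map half_line T_inv"
proof -
  have *: "T_inv -` A \<inter> {0..} \<in> sets half_line \<and> emeasure half_line (T_inv -` A \<inter> {0..}) = emeasure half_line A"
    if A: "A \<in> sets half_line" for A
  proof -
    let ?P = "T_inv -` A \<inter> {0..}" and ?Q = "T ` A - {0}"
    have Q: "?Q \<in> sets half_line" "emeasure half_line ?Q = emeasure half_line A"
      using T_image_sets[OF A] zero_null emeasure_Diff_null_set[OF zero_null] by (auto simp: null_sets_def)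
    have "sym_diff ?P (T ` A) \<subseteq> {0}"
      using A T_inv_vimage by (simp add: sets_half_line)
    then consider "?P = ?Q" | "?P = insert 0 ?Q" by blast
    then show ?thesis
    proof cases
      case 2
      then have P: "?P = ?Q \<union> {0}" by auto
      show ?thesis
        unfolding P using Q emeasure_Un_null_set[OF Q(1) zero_null] null_setsD2[OF zero_null]
        by (intro conjI sets.Un) (simp_all only:)
    qed (use Q in simp)
  qed
  then have "T_inv \<in> measurable half_line half_line"
    using T_inv_nonneg by (intro measurableI) auto
  with * show ?thesis by (simp add: measure_preserving_map_def)
qed

lemma measure_preserving_T_power: "measure_preserving_map half_line (T_power z)"
  using measure_preserving_map_funpow[OF measure_preserving_T] measure_preserving_map_funpow[OF measure_preserving_T_inv]
  by (simp add: int_power_on_def)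

end

section \<open>Distances between copies of a column inside a later column\<close>

context columns
begin

text \<open>
  The heights at which the copies of column \<open>m\<close> start in column \<open>m + p\<close>. The recursion splits off the
  lowest digit, which is the one that a carry in the arithmetic below changes first.
\<close>

primrec copies :: "nat \<Rightarrow> nat \<Rightarrow> nat set" where
  "copies 0 m = {0}"
| "copies (Suc p) m = (\<Union>q\<in>{0, 1, 3, 4}. (\<lambda>a. q * height m + a) ` copies p (Suc m))"

lemma finite_copies: "finite (copies p m)"
  by (induction p arbitrary: m) auto

lemma copies_nested:
  assumes "m \<ge> 1" "i < height m" "a \<in> copies p m"
  shows "i + a < height (m + p) \<and> lev (m + p) (i + a) \<subseteq> lev m i"
  using assms
proof (induction p arbitrary: m i a)
  case (Suc p)
  then obtain q b where q: "q \<in> {0, 1, 3, 4}" and b: "b \<in> copies p (Suc m)" and a: "a = q * height m + b"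
    by (auto simp only: copies.simps UN_iff image_iff)
  have "q * height m \<le> 4 * height m"
    using q by auto
  then have i: "i + q * height m < height (Suc m)"
    using Suc.prems(2) height_Suc[OF Suc.prems(1)] by linarith
  have "i + q * height m + b < height (Suc m + p) \<and> lev (Suc m + p) (i + q * height m + b) \<subseteq> lev (Suc m) (i + q * height m)"
    using Suc.IH[OF _ i b] by simp
  then show ?case
    using lev_next_subset[OF Suc.prems(1) q Suc.prems(2)] by (auto simp: a add.assoc)
qed simp

lemma copies_cover:
  assumes "m \<ge> 1" "i < height m" "x \<in> lev m i"
  shows "\<exists>a\<in>copies p m. x \<in> lev (m + p) (i + a)"
  using assms
proof (induction p arbitrary: m i)
  case (Suc p)
  obtain q where q: "q \<in> {0, 1, 3, 4}" "x \<in> lev (Suc m) (i + q * height m)"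
    using lev_next_cover[OF Suc.prems] .
  have "q * height m \<le> 4 * height m"
    using q by auto
  then have "i + q * height m < height (Suc m)"
    using Suc.prems(2) height_Suc[OF Suc.prems(1)] by linarith
  then obtain b where "b \<in> copies p (Suc m)" "x \<in> lev (Suc m + p) (i + q * height m + b)"
    using Suc.IH[of "Suc m" "i + q * height m"] q(2) by auto
  then show ?case
    using q(1) by (intro bexI[of _ "q * height m + b"]) (auto simp: add.assoc)
qed simp

lemma lev_nested_or_disjoint:
  assumes "m \<ge> 1" "i < height m" "j < height (m + p)"
  shows "lev (m + p) j \<subseteq> lev m i \<or> lev (m + p) j \<inter> lev m i = {}"
proof (rule disjCI)
  assume "lev (m + p) j \<inter> lev m i \<noteq> {}"
  then obtain x where x: "x \<in> lev (m + p) j" "x \<in> lev m i" by blast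
  obtain a where a: "a \<in> copies p m" "x \<in> lev (m + p) (i + a)"
    using copies_cover[OF assms(1,2) x(2)] by blast
  have "j = i + a"
    using lev_disjoint[OF _ assms(3) _ x(1) a(2)] copies_nested[OF assms(1,2) a(1)] assms(1) by simp
  then show "lev (m + p) j \<subseteq> lev m i"
    using copies_nested[OF assms(1,2) a(1)] by simp
qed

lemma copies_mono: "p \<le> p' \<Longrightarrow> copies p m \<subseteq> copies p' m"
proof -
  have "copies p m \<subseteq> copies (Suc p) m" for p
  proof (induction p arbitrary: m)
    case (Suc p)
    then show ?case
      unfolding copies.simps(2)[of "Suc p" m] copies.simps(2)[of p m] by (intro UN_mono image_mono) auto
  qed auto
  then show "p \<le> p' \<Longrightarrow> copies p m \<subseteq> copies p' m"
    by (rule lift_Suc_mono_le)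
qed

definition copy_distance :: "nat \<Rightarrow> nat \<Rightarrow> int \<Rightarrow> bool" where
  "copy_distance p m z \<longleftrightarrow> (\<exists>a\<in>copies p m. \<exists>b\<in>copies p m. int a = int b + z)"

lemma copy_distance_mono: "p \<le> p' \<Longrightarrow> copy_distance p m z \<Longrightarrow> copy_distance p' m z"
  using copies_mono unfolding copy_distance_def by blast

lemma copy_distance_minus: "copy_distance p m z \<Longrightarrow> copy_distance p m (- z)"
  unfolding copy_distance_def by force

text \<open>
  The differences of two elements of \<open>{0, 1, 3, 4}\<close> are exactly the integers between \<open>-4\<close> and \<open>4\<close>. So
  every nonzero residue modulo \<open>5\<close> has a positive and a negative digit, which is the freedom to carry.
\<close>

lemma copy_distance_Suc:
  assumes "\<bar>e\<bar> \<le> 4" "copy_distance p (Suc m) z"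
  shows "copy_distance (Suc p) m (e * int (height m) + z)"
proof -
  have "\<exists>q\<in>{0, 1, 3, 4}. \<exists>q'\<in>{0, 1, 3, 4::nat}. e = int q - int q'"
  proof -
    have "e \<in> {-4, -3, -2, -1, 0, 1, 2, 3, 4}"
      using assms(1) by (simp add: abs_le_iff) presburger
    then show ?thesis by auto
  qed
  then obtain q q' where q: "q \<in> {0, 1, 3, 4}" "q' \<in> {0, 1, 3, 4::nat}" "e = int q - int q'"
    by blast
  obtain a b where ab: "a \<in> copies p (Suc m)" "b \<in> copies p (Suc m)" "int a = int b + z"
    using assms(2) unfolding copy_distance_def by blast
  have "q * height m + a \<in> copies (Suc p) m" "q' * height m + b \<in> copies (Suc p) m"
    using q(1,2) ab(1,2) unfolding copies.simps by blast+
  moreover have "int (q * height m + a) = int (q' * height m + b) + (e * int (height m) + z)"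
    unfolding q(3) of_nat_add of_nat_mult ab(3) by (simp add: algebra_simps)
  ultimately show ?thesis
    unfolding copy_distance_def by blast
qed

text \<open>
  Write \<open>k = 5 k' + e\<close> with a digit \<open>e\<close>. As \<open>5 h\<^sub>m = h\<^sub>m\<^sub>+\<^sub>1 - 1\<close>, the number \<open>k h\<^sub>m + g\<close> equals
  \<open>e h\<^sub>m + (k' h\<^sub>m\<^sub>+\<^sub>1 + (g - k'))\<close>, and the inner number is of the same kind one column later. For
  \<open>k \<le> 4\<close> the division is replaced by the carry \<open>k = 5 \<cdot> 1 + (k - 5)\<close>, which reduces \<open>g\<close> by one, until
  \<open>g = 0\<close> and \<open>k\<close> itself is a digit. In the division \<open>g - k' \<ge> k'\<close> because \<open>g \<ge> k \<ge> 5 k'\<close>, so \<open>g\<close>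
  suffices for the later steps. Each step decreases \<open>k + g\<close>, independently of \<open>m\<close>.
\<close>

lemma copy_distance_height_plus:
  assumes "k \<ge> 1" "k \<le> 4 \<or> k \<le> g"
  shows "\<exists>p. \<forall>m\<ge>1. copy_distance p m (int k * int (height m) + int g)"
  using assms
proof (induction "k + g" arbitrary: k g rule: less_induct)
  case less
  show ?case
  proof (cases "k \<le> 4 \<and> g = 0")
    case True
    have "copy_distance 0 m 0" for m
      by (simp add: copy_distance_def)
    then have "copy_distance (Suc 0) m (int k * int (height m) + 0)" for m
      using True by (intro copy_distance_Suc) auto
    then show ?thesis using True by (intro exI[of _ "Suc 0"]) simp
  next
    case False
    define k' where "k' = (if k \<le> 4 then 1 else k div 5)"
    define e where "e = (if k \<le> 4 then int k - 5 else int (k mod 5))"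
    have k: "int k = 5 * int k' + e"
      unfolding k'_def e_def by (auto simp: zdiv_int zmod_int)
    have k': "k' \<ge> 1" "k' \<le> g" "k' \<le> 4 \<or> k' \<le> g - k'" "k' < k + k'" "\<bar>e\<bar> \<le> 4"
      using False less.prems unfolding k'_def e_def by auto
    then have "k' + (g - k') < k + g"
      using less.prems by linarith
    then obtain p where p: "\<And>m. m \<ge> 1 \<Longrightarrow> copy_distance p m (int k' * int (height m) + int (g - k'))"
      using less.hyps k' by blast
    have "copy_distance (Suc p) m (int k * int (height m) + int g)" if m: "m \<ge> 1" for m
    proof -
      have "copy_distance (Suc p) m (e * int (height m) + (int k' * int (height (Suc m)) + int (g - k')))"
        using p[of "Suc m"] k'(5) by (intro copy_distance_Suc) auto
      moreover have "e * int (height m) + (int k' * int (height (Suc m)) + int (g - k')) = int k * int (height m) + int g"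
        using k'(2) height_Suc[OF m] unfolding k by (simp add: of_nat_diff algebra_simps)
      ultimately show ?thesis by simp
    qed
    then show ?thesis by blast
  qed
qed

text \<open>
  Once \<open>t\<close> exceeds \<open>\<bar>d\<bar>\<close>, the summand \<open>k t - d\<close> has the sign of \<open>k\<close> and a modulus of at least \<open>\<bar>k\<bar>\<close>, so that
  the previous lemma applies to the number or to its negative. That \<open>t\<close> may be arbitrarily large allows
  a common \<open>t\<close> for several \<open>k\<close> and \<open>d\<close>.
\<close>

lemma copy_distance_multiple:
  fixes k d :: int
  assumes k: "k \<noteq> 0" and t: "\<bar>d\<bar> < int t"
  shows "\<exists>p. \<forall>m\<ge>1. copy_distance p m (k * int (height m + t) - d)"
proof -
  have pos: "\<exists>p. \<forall>m\<ge>1. copy_distance p m (k * int (height m + t) - d)"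
    if "k > 0" "\<bar>d\<bar> < int t" for k d :: int
  proof -
    have "k * (1 + \<bar>d\<bar>) \<le> k * int t"
      using that by (intro mult_left_mono) auto
    moreover have "1 * \<bar>d\<bar> \<le> k * \<bar>d\<bar>"
      using that by (intro mult_right_mono) auto
    ultimately have g: "k \<le> k * int t - d"
      by (simp add: algebra_simps)
    have "nat k \<le> nat (k * int t - d)" "1 \<le> nat k"
      using that g by (simp_all add: nat_mono)
    then obtain p where p: "\<forall>m\<ge>1. copy_distance p m (int (nat k) * int (height m) + int (nat (k * int t - d)))"
      using copy_distance_height_plus by blast
    have "int (nat k) = k" "int (nat (k * int t - d)) = k * int t - d"
      using that g by simp_all
    then have "int (nat k) * int (height m) + int (nat (k * int t - d)) = k * int (height m + t) - d" for m
      by (simp only: of_nat_add distrib_left)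
    then show ?thesis
      using p by auto
  qed
  show ?thesis
  proof (cases "k > 0")
    case True
    then show ?thesis using pos t by blast
  next
    case False
    then obtain p where p: "\<forall>m\<ge>1. copy_distance p m (- k * int (height m + t) - - d)"
      using pos[of "- k" "- d"] k t by auto
    have "k * int (height m + t) - d = - (- k * int (height m + t) - - d)" for m
      by simp
    then show ?thesis using p copy_distance_minus by metis
  qed
qed

lemma simultaneous_copy_distances:
  fixes k d :: "nat \<Rightarrow> int"
  assumes "\<And>i. i < r \<Longrightarrow> k i \<noteq> 0"
  obtains p t where "\<And>m i. m \<ge> 1 \<Longrightarrow> i < r \<Longrightarrow> copy_distance p m (k i * int (height m + t) - d i)"
proof -
  define t where "t = Suc (\<Sum>i<r. nat \<bar>d i\<bar>)"
  have "\<bar>d i\<bar> < int t" if "i < r" for i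
  proof -
    have "nat \<bar>d i\<bar> \<le> (\<Sum>i<r. nat \<bar>d i\<bar>)"
      using that by (intro member_le_sum) auto
    then show ?thesis unfolding t_def by linarith
  qed
  then have "\<forall>i\<in>{..<r}. \<exists>p. \<forall>m\<ge>1. copy_distance p m (k i * int (height m + t) - d i)"
    using copy_distance_multiple assms by blast
  then obtain P where P: "\<And>i m. i < r \<Longrightarrow> m \<ge> 1 \<Longrightarrow> copy_distance (P i) m (k i * int (height m + t) - d i)"
    by (metis lessThan_iff)
  have "copy_distance (\<Sum>i<r. P i) m (k i * int (height m + t) - d i)" if "m \<ge> 1" "i < r" for m i
  proof (rule copy_distance_mono)
    show "P i \<le> (\<Sum>i<r. P i)"
      using that(2) by (intro member_le_sum) auto
  qed (rule P[OF that(2,1)])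
  then show ?thesis using that by blast
qed

end

section \<open>Approximation along a refining sequence of finite partitions\<close>

text \<open>
  The measurable unions of atoms of the partition \<open>P\<close>.
\<close>

definition saturated :: "'a measure \<Rightarrow> 'a set set \<Rightarrow> 'a set set" where
  "saturated M P = {U \<in> sets M. \<forall>A\<in>P. A \<subseteq> U \<or> A \<inter> U = {}}"

text \<open>
  Requiring approximations at all late stages, not just at one, makes closure under unions immediate:
  approximations of two sets can be taken at a common stage without refining either of them.
\<close>

definition approximable :: "'a measure \<Rightarrow> (nat \<Rightarrow> 'a set set) \<Rightarrow> 'a set \<Rightarrow> bool" where
  "approximable M P E \<longleftrightarrow> E \<in> sets M \<and>
     (\<forall>e>0. \<forall>\<^sub>F p in sequentially. \<exists>U\<in>saturated M (P p). measure M (sym_diff E U) < e)"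

lemma approximableD:
  "approximable M P E \<Longrightarrow> e > 0 \<Longrightarrow>
    \<forall>\<^sub>F p in sequentially. \<exists>U\<in>saturated M (P p). measure M (sym_diff E U) < e"
  by (simp add: approximable_def)

lemma saturated_Un: "U \<in> saturated M P \<Longrightarrow> V \<in> saturated M P \<Longrightarrow> U \<union> V \<in> saturated M P"
  unfolding saturated_def by (auto 4 0 simp: Int_Un_distrib)

lemma saturated_Diff: "U \<in> saturated M P \<Longrightarrow> P \<subseteq> Pow (space M) \<Longrightarrow> space M - U \<in> saturated M P"
  unfolding saturated_def by (auto 4 0 simp: subset_iff disjoint_iff)

context finite_measure
begin

lemma approximable_Diff:
  assumes "\<And>p. P p \<subseteq> Pow (space M)" "approximable M P E"
  shows "approximable M P (space M - E)"
  unfolding approximable_def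
proof (intro conjI allI impI)
  show "space M - E \<in> sets M"
    using assms(2) by (auto simp: approximable_def)
  fix e :: real assume "e > 0"
  then have "\<forall>\<^sub>F p in sequentially. \<exists>U\<in>saturated M (P p). measure M (sym_diff E U) < e"
    using assms(2) by (auto simp: approximable_def)
  then show "\<forall>\<^sub>F p in sequentially. \<exists>U\<in>saturated M (P p). measure M (sym_diff (space M - E) U) < e"
  proof eventually_elim
    case (elim p)
    then obtain U where U: "U \<in> saturated M (P p)" "measure M (sym_diff E U) < e" by blast
    have "E \<subseteq> space M" "U \<subseteq> space M"
      using assms(2) U(1) sets.sets_into_space by (auto simp: approximable_def saturated_def)
    then have "sym_diff (space M - E) (space M - U) = sym_diff E U" by blast
    then show ?case
      using saturated_Diff[OF U(1) assms(1)] U(2) by (intro bexI[of _ "space M - U"]) auto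
  qed
qed

lemma approximable_Un:
  assumes "approximable M P E" "approximable M P F"
  shows "approximable M P (E \<union> F)"
  unfolding approximable_def
proof (intro conjI allI impI)
  have [measurable]: "E \<in> sets M" "F \<in> sets M"
    using assms by (auto simp: approximable_def)
  show "E \<union> F \<in> sets M" by simp
  fix e :: real assume "e > 0"
  then have "\<forall>\<^sub>F p in sequentially. \<exists>U\<in>saturated M (P p). measure M (sym_diff E U) < e / 2"
    "\<forall>\<^sub>F p in sequentially. \<exists>U\<in>saturated M (P p). measure M (sym_diff F U) < e / 2"
    using assms by (auto intro!: approximableD simp del: less_divide_eq_numeral1)
  then show "\<forall>\<^sub>F p in sequentially. \<exists>U\<in>saturated M (P p). measure M (sym_diff (E \<union> F) U) < e"
  proof eventually_elim
    case (elim p)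
    then obtain U V where U: "U \<in> saturated M (P p)" "measure M (sym_diff E U) < e / 2"
      and V: "V \<in> saturated M (P p)" "measure M (sym_diff F V) < e / 2" by blast
    have [measurable]: "U \<in> sets M" "V \<in> sets M"
      using U V by (auto simp: saturated_def)
    have "measure M (sym_diff (E \<union> F) (U \<union> V)) \<le> measure M (sym_diff E U \<union> sym_diff F V)"
      by (intro finite_measure_mono) auto
    also have "\<dots> \<le> measure M (sym_diff E U) + measure M (sym_diff F V)"
      by (intro measure_Un_le) auto
    finally show ?case
      using U V saturated_Un by (intro bexI[of _ "U \<union> V"]) auto
  qed
qed

lemma approximable_null:
  assumes "N \<in> null_sets M"
  shows "approximable M P N"
proof -
  have "measure M N = 0"
    using assms by (simp add: measure_def null_sets_def)
  then show ?thesis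
    using assms unfolding approximable_def
    by (auto simp: saturated_def intro!: always_eventually bexI[of _ "{}"])
qed

lemma approximable_finite_Union:
  "(\<And>n. approximable M P (E n)) \<Longrightarrow> approximable M P (\<Union>i<(n::nat). E i)"
proof (induction n)
  case 0
  then show ?case using approximable_null[of "{}"] by simp
next
  case (Suc n)
  then show ?case using approximable_Un by (simp add: lessThan_Suc)
qed

text \<open>
  In a finite measure space, finitely many of the sets exhaust the union up to a small measure.
\<close>

lemma approximable_Union:
  fixes E :: "nat \<Rightarrow> 'a set"
  assumes E: "\<And>n. approximable M P (E n)"
  shows "approximable M P (\<Union>n. E n)"
  unfolding approximable_def
proof (intro conjI allI impI)
  have m: "E n \<in> sets M" for n
    using E by (auto simp: approximable_def)
  then show U: "(\<Union>n. E n) \<in> sets M" by blast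
  fix e :: real assume e: "e > 0"
  let ?F = "\<lambda>n. \<Union>i<n. E i"
  have Fm: "?F n \<in> sets M" for n
    using m by blast
  have "(\<lambda>n. measure M ((\<Union>n. E n) - ?F n)) \<longlonglongrightarrow> measure M (\<Inter>n. (\<Union>n. E n) - ?F n)"
    using U Fm by (intro finite_Lim_measure_decseq) (auto simp: decseq_def)
  also have "(\<Inter>n. (\<Union>n. E n) - ?F n) = {}" by auto
  finally have "(\<lambda>n. measure M ((\<Union>n. E n) - ?F n)) \<longlonglongrightarrow> 0" by simp
  then have "\<forall>\<^sub>F n in sequentially. measure M ((\<Union>n. E n) - ?F n) < e / 2"
    using e by (intro order_tendstoD) auto
  then obtain n where n: "measure M ((\<Union>n. E n) - ?F n) < e / 2"
    by (auto simp: eventually_sequentially)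
  have "approximable M P (?F n)"
    using E by (rule approximable_finite_Union)
  then have "\<forall>\<^sub>F p in sequentially. \<exists>U\<in>saturated M (P p). measure M (sym_diff (?F n) U) < e / 2"
    using e by (intro approximableD) auto
  then show "\<forall>\<^sub>F p in sequentially. \<exists>U\<in>saturated M (P p). measure M (sym_diff (\<Union>n. E n) U) < e"
  proof eventually_elim
    case (elim p)
    then obtain V where V: "V \<in> saturated M (P p)" "measure M (sym_diff (?F n) V) < e / 2" by blast
    have [measurable]: "V \<in> sets M" "?F n \<in> sets M" "(\<Union>n. E n) \<in> sets M"
      using V Fm U by (auto simp: saturated_def)
    have "measure M (sym_diff (\<Union>n. E n) V) \<le> measure M (((\<Union>n. E n) - ?F n) \<union> sym_diff (?F n) V)"
      by (intro finite_measure_mono sets.Un sets.Diff) (use Fm U V in \<open>auto simp: saturated_def\<close>)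
    also have "\<dots> \<le> measure M ((\<Union>n. E n) - ?F n) + measure M (sym_diff (?F n) V)"
      by (intro measure_Un_le sets.Un sets.Diff) (use Fm U V in \<open>auto simp: saturated_def\<close>)
    finally show ?case
      using V n by (intro bexI[of _ V]) auto
  qed
qed

text \<open>
  Let \<open>U\<close> be a union of atoms close to \<open>E\<close>. If \<open>E\<close> missed at least the fraction \<open>\<epsilon>\<close> of every atom of
  \<open>U\<close>, it would miss the fraction \<open>\<epsilon>\<close> of \<open>U\<close>, which is too much.
\<close>

lemma approximable_dense_atom:
  assumes P: "\<And>p. finite (P p)" "\<And>p. disjoint (P p)" "\<And>p. P p \<subseteq> sets M" "\<And>p. \<Union>(P p) = space M"
    and E: "approximable M P E" "measure M E > 0" and eps: "\<epsilon> > 0"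
  shows "\<forall>\<^sub>F p in sequentially. \<exists>A\<in>P p. measure M (A - E) < \<epsilon> * measure M A"
proof -
  define c where "c = measure M E"
  define \<eta> where "\<eta> = min \<epsilon> 1"
  define \<delta> where "\<delta> = \<eta> * c / 3"
  have eta: "0 < \<eta>" "\<eta> \<le> 1" "\<eta> \<le> \<epsilon>" and c: "c > 0" and delta: "\<delta> > 0"
    using eps E(2) by (auto simp: \<eta>_def c_def \<delta>_def)
  have Em: "E \<in> sets M"
    using E(1) by (simp add: approximable_def)
  have "\<forall>\<^sub>F p in sequentially. \<exists>U\<in>saturated M (P p). measure M (sym_diff E U) < \<delta>"
    using E(1) delta by (simp add: approximable_def)
  then show ?thesis
  proof eventually_elim
    case (elim p)
    then obtain U where U: "U \<in> saturated M (P p)" and Ud: "measure M (sym_diff E U) < \<delta>" by blast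
    have Um: "U \<in> sets M" and "U \<subseteq> space M"
      using U sets.sets_into_space by (auto simp: saturated_def)
    define Q where "Q = {A \<in> P p. A \<subseteq> U}"
    have UQ: "U = (\<Union>A\<in>Q. A)"
    proof (intro equalityI subsetI)
      fix x assume x: "x \<in> U"
      with \<open>U \<subseteq> space M\<close> obtain A where A: "A \<in> P p" "x \<in> A"
        unfolding P(4)[of p, symmetric] by blast
      then have "A \<subseteq> U"
        using U x unfolding saturated_def by blast
      with A show "x \<in> (\<Union>A\<in>Q. A)"
        unfolding Q_def by blast
    qed (auto simp: Q_def)
    then have UQE: "U - E = (\<Union>A\<in>Q. A - E)" by blast
    have Q: "finite Q" "Q \<subseteq> sets M" "disjoint_family_on (\<lambda>A. A) Q" "disjoint_family_on (\<lambda>A. A - E) Q"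
      using P(1-3)[of p] by (auto simp: Q_def disjoint_def disjoint_family_on_def)
    have mU: "measure M U = (\<Sum>A\<in>Q. measure M A)"
      unfolding UQ using Q by (intro finite_measure_finite_Union) auto
    have mUE: "measure M (U - E) = (\<Sum>A\<in>Q. measure M (A - E))"
      unfolding UQE using Q Em by (intro finite_measure_finite_Union) auto
    show ?case
    proof (rule ccontr)
      assume "\<not> ?thesis"
      then have "(\<Sum>A\<in>Q. \<epsilon> * measure M A) \<le> (\<Sum>A\<in>Q. measure M (A - E))"
        by (intro sum_mono) (auto simp: Q_def not_less)
      then have 1: "\<epsilon> * measure M U \<le> measure M (U - E)"
        unfolding mU mUE by (simp add: sum_distrib_left)
      have 2: "measure M (U - E) < \<delta>" "measure M (E - U) < \<delta>"
        using Ud Em Um by (auto intro!: order.strict_trans1[OF finite_measure_mono Ud])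
      have "c \<le> measure M (U \<union> (E - U))"
        unfolding c_def using Em Um by (intro finite_measure_mono) auto
      also have "\<dots> \<le> measure M U + measure M (E - U)"
        using Em Um by (intro measure_Un_le) auto
      finally have 3: "c - \<delta> \<le> measure M U"
        using 2 by simp
      have "\<eta> * (c - \<delta>) \<le> \<eta> * measure M U"
        using 3 eta by (intro mult_left_mono) auto
      also have "\<dots> \<le> \<epsilon> * measure M U"
        using eta by (intro mult_right_mono) auto
      also have "\<dots> < \<delta>"
        using 1 2 by linarith
      finally have "\<eta> * c - \<eta> * \<delta> < \<delta>"
        by (simp add: algebra_simps)
      moreover have "\<eta> * \<delta> \<le> 1 * \<delta>"
        using eta delta by (intro mult_right_mono) auto
      moreover have "\<eta> * c = 3 * \<delta>"
        by (simp add: \<delta>_def)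
      ultimately show False using delta by linarith
    qed
  qed
qed

end

section \<open>Density of measurable sets in products of levels\<close>

context columns
begin

definition level_box :: "nat \<Rightarrow> nat \<Rightarrow> (nat \<Rightarrow> nat) \<Rightarrow> (nat \<Rightarrow> real) set" where
  "level_box r m \<alpha> = (\<Pi>\<^sub>E i\<in>{..<r}. lev m (\<alpha> i))"

text \<open>
  The partition of a product of levels of column \<open>m\<close> into products of levels of column \<open>m + p\<close>. The parts
  are listed by positions of copies instead of indices of levels: equal positions in two different
  boxes mean that the parts differ by the same displacement as the boxes.
\<close>

definition subboxes :: "nat \<Rightarrow> nat \<Rightarrow> (nat \<Rightarrow> nat) \<Rightarrow> nat \<Rightarrow> (nat \<Rightarrow> real) set set" where
  "subboxes r m \<alpha> p = (\<lambda>a. level_box r (m + p) (\<lambda>i. \<alpha> i + a i)) ` (\<Pi>\<^sub>E i\<in>{..<r}. copies p m)"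

lemma product_sigma_finite_half_line: "product_sigma_finite (\<lambda>_::nat. half_line)"
  using sigma_finite_half_line by (simp add: product_sigma_finite_def)

lemma emeasure_lev: "m \<ge> 1 \<Longrightarrow> i < height m \<Longrightarrow> emeasure half_line (lev m i) = ennreal (col_width m)"
  using lev_nonneg[of m i] col_width_pos[of m] unfolding lev_def by (intro emeasure_half_line_level) auto

lemma box_sets_PiM:
  assumes "m \<ge> 1" "\<And>i. i < r \<Longrightarrow> \<alpha> i < height m"
  shows "level_box r m \<alpha> \<in> sets (\<Pi>\<^sub>M i\<in>{..<r}. half_line)"
  unfolding level_box_def using assms lev_sets by (intro sets_PiM_I_finite) auto

lemma emeasure_power_space_PiE:
  assumes "\<And>i. i < r \<Longrightarrow> A i \<in> sets half_line"
  shows "emeasure (power_space r) (\<Pi>\<^sub>E i\<in>{..<r}. A i) = (\<Prod>i<r. emeasure half_line (A i))"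
proof -
  interpret product_sigma_finite "\<lambda>_::nat. half_line" by (rule product_sigma_finite_half_line)
  have "(\<Pi>\<^sub>E i\<in>{..<r}. A i) \<in> sets (\<Pi>\<^sub>M i\<in>{..<r}. half_line)"
    using assms by (intro sets_PiM_I_finite) auto
  then have "emeasure (power_space r) (\<Pi>\<^sub>E i\<in>{..<r}. A i) = emeasure (\<Pi>\<^sub>M i\<in>{..<r}. half_line) (\<Pi>\<^sub>E i\<in>{..<r}. A i)"
    by (simp add: power_space_def)
  also have "\<dots> = (\<Prod>i<r. emeasure half_line (A i))"
    using assms by (intro emeasure_PiM) auto
  finally show ?thesis .
qed

lemma emeasure_box:
  assumes "m \<ge> 1" "\<And>i. i < r \<Longrightarrow> \<alpha> i < height m"
  shows "emeasure (power_space r) (level_box r m \<alpha>) = ennreal (col_width m ^ r)"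
proof -
  have "emeasure (power_space r) (level_box r m \<alpha>) = (\<Prod>i<r. emeasure half_line (lev m (\<alpha> i)))"
    unfolding level_box_def using assms lev_sets by (intro emeasure_power_space_PiE) auto
  also have "\<dots> = (\<Prod>i<r. ennreal (col_width m))"
    using assms by (intro prod.cong) (auto simp: emeasure_lev)
  finally show ?thesis
    using col_width_pos[of m] by (simp add: ennreal_power)
qed

lemma box_sets: "m \<ge> 1 \<Longrightarrow> (\<And>i. i < r \<Longrightarrow> \<alpha> i < height m) \<Longrightarrow> level_box r m \<alpha> \<in> sets (power_space r)"
  unfolding power_space_def by (intro sets_completionI_sets box_sets_PiM)

lemma measure_box:
  "m \<ge> 1 \<Longrightarrow> (\<And>i. i < r \<Longrightarrow> \<alpha> i < height m) \<Longrightarrow> measure (power_space r) (level_box r m \<alpha>) = col_width m ^ r"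
  using emeasure_box[of m r \<alpha>] col_width_pos[of m] by (simp add: measure_def)

lemma space_power_space: "space (power_space r) = (\<Pi>\<^sub>E i\<in>{..<r}. {0..})"
  by (simp add: power_space_def space_PiM)

lemma box_space: "m \<ge> 1 \<Longrightarrow> (\<And>i. i < r \<Longrightarrow> \<alpha> i < height m) \<Longrightarrow> level_box r m \<alpha> \<subseteq> space (power_space r)"
  using box_sets sets.sets_into_space by blast

context
  fixes r m :: nat and \<alpha> :: "nat \<Rightarrow> nat"
  assumes m: "m \<ge> 1" and \<alpha>: "\<And>i. i < r \<Longrightarrow> \<alpha> i < height m"
begin

lemma subbox_index:
  "a \<in> (\<Pi>\<^sub>E i\<in>{..<r}. copies p m) \<Longrightarrow> i < r \<Longrightarrow> \<alpha> i + a i < height (m + p)"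
  using copies_nested[OF m \<alpha>] by (auto simp: PiE_iff)

lemma subboxes_finite: "finite (subboxes r m \<alpha> p)"
  unfolding subboxes_def by (intro finite_imageI finite_PiE) (auto simp: finite_copies)

lemma subboxes_disjoint: "disjoint (subboxes r m \<alpha> p)"
proof (rule disjointI)
  fix A B assume "A \<in> subboxes r m \<alpha> p" "B \<in> subboxes r m \<alpha> p" and "A \<noteq> B"
  then obtain a b where a: "a \<in> (\<Pi>\<^sub>E i\<in>{..<r}. copies p m)" "A = level_box r (m + p) (\<lambda>i. \<alpha> i + a i)"
    and b: "b \<in> (\<Pi>\<^sub>E i\<in>{..<r}. copies p m)" "B = level_box r (m + p) (\<lambda>i. \<alpha> i + b i)"
    by (auto simp: subboxes_def)
  show "A \<inter> B = {}"
  proof (rule ccontr)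
    assume "A \<inter> B \<noteq> {}"
    then obtain x where x: "x \<in> A" "x \<in> B" by blast
    have "\<alpha> i + a i = \<alpha> i + b i" if "i < r" for i
      using lev_disjoint[OF _ subbox_index[OF a(1) that] subbox_index[OF b(1) that], of "x i"] m x that
      by (auto simp: a(2) b(2) level_box_def)
    then have "A = B"
      unfolding a(2) b(2) level_box_def by (intro PiE_cong) auto
    with \<open>A \<noteq> B\<close> show False ..
  qed
qed

lemma subboxes_Union: "\<Union>(subboxes r m \<alpha> p) = level_box r m \<alpha>"
proof (intro equalityI subsetI)
  fix x assume "x \<in> \<Union>(subboxes r m \<alpha> p)"
  then obtain a where a: "a \<in> (\<Pi>\<^sub>E i\<in>{..<r}. copies p m)" "x \<in> level_box r (m + p) (\<lambda>i. \<alpha> i + a i)"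
    by (auto simp: subboxes_def)
  then show "x \<in> level_box r m \<alpha>"
    using copies_nested[OF m \<alpha>] unfolding level_box_def PiE_iff by blast
next
  fix x assume x: "x \<in> level_box r m \<alpha>"
  then have "\<forall>i\<in>{..<r}. \<exists>a\<in>copies p m. x i \<in> lev (m + p) (\<alpha> i + a)"
    using copies_cover[OF m \<alpha>] PiE_mem[of x "{..<r}" "\<lambda>i. lev m (\<alpha> i)"] unfolding level_box_def by blast
  then obtain a where a: "\<And>i. i < r \<Longrightarrow> a i \<in> copies p m \<and> x i \<in> lev (m + p) (\<alpha> i + a i)"
    by (metis lessThan_iff)
  have "restrict a {..<r} \<in> (\<Pi>\<^sub>E i\<in>{..<r}. copies p m)"
    using a by auto
  moreover have "x \<in> level_box r (m + p) (\<lambda>i. \<alpha> i + restrict a {..<r} i)"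
    using x a by (auto simp: level_box_def PiE_iff)
  ultimately show "x \<in> \<Union>(subboxes r m \<alpha> p)"
    unfolding subboxes_def by blast
qed

lemma subboxes_sets: "subboxes r m \<alpha> p \<subseteq> sets (power_space r)"
  using subbox_index m by (auto simp: subboxes_def intro!: box_sets)

abbreviation "box_space_measure \<equiv> restrict_space (power_space r) (level_box r m \<alpha>)"

lemma sets_box_space: "A \<in> sets box_space_measure \<longleftrightarrow> A \<subseteq> level_box r m \<alpha> \<and> A \<in> sets (power_space r)"
  using box_sets[OF m \<alpha>] by (subst sets_restrict_space_iff) auto

lemma space_box_space: "space box_space_measure = level_box r m \<alpha>"
  using box_space[of m r \<alpha>, OF m \<alpha>] by (simp add: space_restrict_space Int_absorb2)

lemma measure_box_space: "A \<subseteq> level_box r m \<alpha> \<Longrightarrow> measure box_space_measure A = measure (power_space r) A"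
  using box_sets[OF m \<alpha>] by (intro measure_restrict_space) auto

lemma null_sets_box_space: "N \<in> null_sets (power_space r) \<Longrightarrow> N \<inter> level_box r m \<alpha> \<in> null_sets box_space_measure"
  using box_sets[OF m \<alpha>] null_set_Int2[of N "power_space r" "level_box r m \<alpha>"]
  by (subst null_sets_restrict_space) auto

lemma finite_measure_box_space: "finite_measure box_space_measure"
proof (rule finite_measureI)
  show "emeasure box_space_measure (space box_space_measure) \<noteq> \<infinity>"
    unfolding space_box_space using emeasure_box[OF m \<alpha>] box_sets[OF m \<alpha>]
    by (subst emeasure_restrict_space) auto
qed

interpretation finite_measure box_space_measure
  by (rule finite_measure_box_space)

abbreviation approx :: "(nat \<Rightarrow> real) set \<Rightarrow> bool" where
  "approx \<equiv> approximable box_space_measure (subboxes r m \<alpha>)"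

lemma subboxes_Pow: "subboxes r m \<alpha> p \<subseteq> Pow (space box_space_measure)"
  using subboxes_Union[of p] space_box_space by auto

definition cylinder :: "nat \<Rightarrow> real set \<Rightarrow> (nat \<Rightarrow> real) set" where
  "cylinder i A = {x \<in> level_box r m \<alpha>. x i \<in> A}"

lemma cylinder_eq:
  assumes i: "i < r"
  shows "cylinder i A = (\<Pi>\<^sub>E j\<in>{..<r}. lev m (\<alpha> j) \<inter> (if j = i then A else UNIV))"
proof (intro equalityI subsetI)
  fix x assume "x \<in> cylinder i A"
  then show "x \<in> (\<Pi>\<^sub>E j\<in>{..<r}. lev m (\<alpha> j) \<inter> (if j = i then A else UNIV))"
    unfolding cylinder_def level_box_def by (intro PiE_I) auto
next
  fix x assume x: "x \<in> (\<Pi>\<^sub>E j\<in>{..<r}. lev m (\<alpha> j) \<inter> (if j = i then A else UNIV))"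
  then have "x j \<in> lev m (\<alpha> j)" if "j < r" for j
    using PiE_mem[OF x, of j] that by simp
  moreover have "x i \<in> A"
    using PiE_mem[OF x, of i] i by simp
  ultimately show "x \<in> cylinder i A"
    using x unfolding cylinder_def level_box_def by (auto simp: PiE_iff)
qed

lemma cylinder_sets:
  assumes "i < r" "A \<in> sets lebesgue"
  shows "cylinder i A \<in> sets box_space_measure"
proof -
  have "lev m (\<alpha> j) \<inter> (if j = i then A else UNIV) \<in> sets half_line" if "j < r" for j
    using lev_sets[OF m \<alpha>[OF that]] assms(2) by (auto simp: sets_half_line)
  then have "cylinder i A \<in> sets (power_space r)"
    unfolding power_space_def cylinder_eq[OF assms(1)]
    by (intro sets_PiM_I_finite sets_completionI_sets) auto
  then show ?thesis
    by (auto simp: sets_box_space cylinder_def)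
qed

text \<open>
  A level of column \<open>m + p\<close> is a union of levels of each later column, so from stage \<open>p\<close> on the
  cylinder is a union of parts of the partition and approximates itself.
\<close>

lemma approx_cylinder_lev:
  assumes i: "i < r" and b: "b \<in> copies p m"
  shows "approx (cylinder i (lev (m + p) (\<alpha> i + b)))"
  unfolding approximable_def
proof (intro conjI allI impI)
  let ?U = "cylinder i (lev (m + p) (\<alpha> i + b))"
  have idx: "\<alpha> i + b < height (m + p)"
    using copies_nested[OF m \<alpha>[OF i] b] by simp
  have "lev (m + p) (\<alpha> i + b) \<in> sets lebesgue"
    using lev_sets[OF _ idx] m by (simp add: sets_half_line)
  then show U: "?U \<in> sets box_space_measure"
    using cylinder_sets[OF i] by blast
  fix e :: real assume e: "e > 0"
  show "\<forall>\<^sub>F p in sequentially. \<exists>V\<in>saturated box_space_measure (subboxes r m \<alpha> p).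
      measure box_space_measure (sym_diff ?U V) < e"
    using eventually_ge_at_top[of p]
  proof eventually_elim
    case (elim p')
    have "A \<subseteq> ?U \<or> A \<inter> ?U = {}" if A: "A \<in> subboxes r m \<alpha> p'" for A
    proof -
      obtain a where a: "a \<in> (\<Pi>\<^sub>E i\<in>{..<r}. copies p' m)" "A = level_box r (m + p') (\<lambda>i. \<alpha> i + a i)"
        using A by (auto simp: subboxes_def)
      have "A \<subseteq> level_box r m \<alpha>"
        using A subboxes_Union[of p'] by blast
      moreover have "lev (m + p') (\<alpha> i + a i) \<subseteq> lev (m + p) (\<alpha> i + b) \<or>
          lev (m + p') (\<alpha> i + a i) \<inter> lev (m + p) (\<alpha> i + b) = {}"
        using lev_nested_or_disjoint[OF _ idx, of "\<alpha> i + a i" "p' - p"] subbox_index[OF a(1) i] m elim by simp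
      ultimately show ?thesis
        using i unfolding a(2) cylinder_def by (auto simp: level_box_def PiE_iff)
    qed
    then have "?U \<in> saturated box_space_measure (subboxes r m \<alpha> p')"
      using U by (simp add: saturated_def)
    then show ?case
      using e by (intro bexI[of _ ?U]) auto
  qed
qed

lemma approx_UN:
  assumes "countable I" "\<And>i. i \<in> I \<Longrightarrow> approx (A i)"
  shows "approx (\<Union>i\<in>I. A i)"
proof (cases "I = {}")
  case True
  then show ?thesis using approximable_null[of "{}"] by simp
next
  case False
  have "(\<Union>i\<in>I. A i) = (\<Union>i\<in>range (from_nat_into I). A i)"
    using range_from_nat_into[OF False assms(1)] by simp
  then have "(\<Union>i\<in>I. A i) = (\<Union>n. A (from_nat_into I n))"
    by simp
  then show ?thesis
    using approximable_Union[of "subboxes r m \<alpha>" "\<lambda>n. A (from_nat_into I n)"] assms(2) from_nat_into[OF False] by simp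
qed

text \<open>
  The widths of the levels tend to \<open>0\<close>, so an open set is a countable union of levels inside the given
  level.
\<close>

lemma approx_cylinder_open:
  assumes i: "i < r" and S: "open S"
  shows "approx (cylinder i S)"
proof -
  define I where "I = {(p, b). b \<in> copies p m \<and> lev (m + p) (\<alpha> i + b) \<subseteq> S}"
  have "cylinder i S = (\<Union>(p, b)\<in>I. cylinder i (lev (m + p) (\<alpha> i + b)))"
  proof (intro equalityI subsetI)
    fix x assume x: "x \<in> cylinder i S"
    then have xi: "x i \<in> S" "x i \<in> lev m (\<alpha> i)"
      using i by (auto simp: cylinder_def level_box_def)
    obtain e where e: "e > 0" "\<And>y. \<bar>y - x i\<bar> < e \<Longrightarrow> y \<in> S"
      using S xi(1) by (metis openE dist_real_def mem_ball subsetD dist_commute)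
    obtain p where p: "(1/4) ^ p < e"
      using e(1) real_arch_pow_inv[of e "1/4"] by auto
    obtain b where b: "b \<in> copies p m" "x i \<in> lev (m + p) (\<alpha> i + b)"
      using copies_cover[OF m \<alpha>[OF i] xi(2)] by blast
    have "(1/4::real) ^ (m + p - 1) \<le> (1/4) ^ p"
      using m by (intro power_decreasing) auto
    then have "col_width (m + p) < e"
      using p by (simp add: col_width_def power_one_over)
    then have "lev (m + p) (\<alpha> i + b) \<subseteq> S"
      using b(2) by (auto simp: lev_def level_def intro!: e(2))
    then show "x \<in> (\<Union>(p, b)\<in>I. cylinder i (lev (m + p) (\<alpha> i + b)))"
      using b x by (auto simp: I_def cylinder_def)
  qed (auto simp: I_def cylinder_def)
  then show ?thesis
    using approx_cylinder_lev[OF i] by (auto simp: I_def intro!: approx_UN)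
qed

lemma approx_cylinder_borel:
  assumes i: "i < r" and S: "S \<in> sets borel"
  shows "approx (cylinder i S)"
proof -
  have "S \<in> sigma_sets UNIV {S. open S}"
    using S by (simp add: borel_def)
  then show ?thesis
  proof induction
    case (Basic S)
    then show ?case using approx_cylinder_open[OF i] by simp
  next
    case Empty
    then show ?case using approximable_null[of "{}"] by (simp add: cylinder_def)
  next
    case (Compl S)
    have "cylinder i (UNIV - S) = space box_space_measure - cylinder i S"
      by (auto simp: cylinder_def space_box_space)
    then show ?case
      using approximable_Diff[OF subboxes_Pow Compl.IH] by simp
  next
    case (Union S)
    have "cylinder i (\<Union>n. S n) = (\<Union>n. cylinder i (S n))"
      by (auto simp: cylinder_def)
    then show ?case
      using approximable_Union[OF Union.IH] by simp
  qed
qed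

text \<open>
  The factor measure is Lebesgue measure on the Lebesgue sets, so null sets that are not Borel occur
  already in the factors.
\<close>

lemma approx_cylinder:
  assumes i: "i < r" and A: "A \<in> sets lebesgue"
  shows "approx (cylinder i A)"
proof -
  obtain S N N' where S: "A = S \<union> N" "N \<subseteq> N'" "N' \<in> null_sets lborel" "S \<in> sets lborel"
    using A by (rule sets_completionE)
  have Nn: "N \<in> null_sets lebesgue"
    using S(2,3) by (auto simp: null_sets_completion_iff2)
  let ?B = "\<lambda>j. lev m (\<alpha> j) \<inter> (if j = i then N else UNIV)"
  have B: "?B j \<in> sets half_line" if "j < r" for j
    using lev_sets[OF m \<alpha>[OF that]] Nn by (auto simp: sets_half_line)
  have "emeasure half_line (?B i) = 0"
  proof -
    have "?B i \<in> null_sets lebesgue"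
      using Nn lev_sets[OF m \<alpha>[OF i]] null_set_Int1[of N lebesgue "lev m (\<alpha> i)"]
      by (simp add: Int_commute sets_half_line)
    then show ?thesis
      unfolding emeasure_half_line[OF B[OF i]] by (rule null_setsD1)
  qed
  then have "(\<Prod>j<r. emeasure half_line (?B j)) = 0"
    using i by (intro prod_zero bexI[of _ i]) auto
  then have "emeasure (power_space r) (cylinder i N) = 0"
    using emeasure_power_space_PiE[of r ?B, OF B] unfolding cylinder_eq[OF i] by metis
  moreover have "cylinder i N \<in> sets (power_space r)"
    using cylinder_sets[OF i, of N] Nn by (auto simp: sets_box_space)
  ultimately have "cylinder i N \<in> null_sets (power_space r)" by auto
  then have "approx (cylinder i N \<inter> level_box r m \<alpha>)"
    by (intro approximable_null null_sets_box_space)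
  moreover have "cylinder i N \<inter> level_box r m \<alpha> = cylinder i N" by (auto simp: cylinder_def)
  moreover have "cylinder i A = cylinder i S \<union> cylinder i N"
    by (auto simp: cylinder_def S(1))
  ultimately show ?thesis
    using approx_cylinder_borel[OF i, of S] S(4) approximable_Un by simp
qed

lemma approx_sets_PiM:
  assumes "E \<in> sets (\<Pi>\<^sub>M i\<in>{..<r}. half_line)"
  shows "approx (E \<inter> level_box r m \<alpha>)"
proof -
  let ?X = "\<Pi>\<^sub>E i\<in>{..<r}. space half_line"
  have boxX: "level_box r m \<alpha> \<subseteq> ?X"
    using box_space[OF m \<alpha>] by (simp add: space_power_space)
  have "E \<in> sigma_sets ?X {{f\<in>?X. f i \<in> A} | i A. i \<in> {..<r} \<and> A \<in> sets half_line}"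
    using assms unfolding sets_PiM_single .
  then show ?thesis
  proof induction
    case (Basic E)
    then obtain i A where "i < r" "A \<in> sets half_line" "E = {f\<in>?X. f i \<in> A}" by auto
    then have "E \<inter> level_box r m \<alpha> = cylinder i A" "A \<in> sets lebesgue"
      using boxX by (auto simp: cylinder_def sets_half_line)
    then show ?case using approx_cylinder[OF \<open>i < r\<close>] by simp
  next
    case Empty
    then show ?case using approximable_null[of "{}"] by simp
  next
    case (Compl E)
    have "(?X - E) \<inter> level_box r m \<alpha> = space box_space_measure - E \<inter> level_box r m \<alpha>"
      using boxX unfolding space_box_space by blast
    then show ?case
      using approximable_Diff[OF subboxes_Pow Compl.IH] by simp
  next
    case (Union E)
    have "(\<Union>n. E n) \<inter> level_box r m \<alpha> = (\<Union>n. E n \<inter> level_box r m \<alpha>)" by blast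
    then show ?case
      using approximable_Union[OF Union.IH] by simp
  qed
qed

lemma approx_sets:
  assumes "E \<in> sets (power_space r)"
  shows "approx (E \<inter> level_box r m \<alpha>)"
proof -
  obtain S N N' where S: "E = S \<union> N" "N \<subseteq> N'" "N' \<in> null_sets (\<Pi>\<^sub>M i\<in>{..<r}. half_line)"
      "S \<in> sets (\<Pi>\<^sub>M i\<in>{..<r}. half_line)"
    using assms unfolding power_space_def by (rule sets_completionE)
  have "N \<in> null_sets (power_space r)"
    using S(2,3) by (auto simp: power_space_def null_sets_completion_iff2)
  then have "approx (N \<inter> level_box r m \<alpha>)"
    by (intro approximable_null null_sets_box_space)
  then show ?thesis
    using approximable_Un[OF approx_sets_PiM[OF S(4)]] by (simp add: S(1) Int_Un_distrib2)
qed

text \<open>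
  A substitute for the Lebesgue density theorem: along the columns, a set of positive measure in a
  product of levels nearly fills one of the small products, at every late stage.
\<close>

lemma dense_subbox:
  assumes E: "E \<in> sets (power_space r)" "emeasure (power_space r) (E \<inter> level_box r m \<alpha>) > 0" and eps: "\<epsilon> > 0"
  shows "\<forall>\<^sub>F p in sequentially. \<exists>a\<in>(\<Pi>\<^sub>E i\<in>{..<r}. copies p m).
    measure (power_space r) (level_box r (m + p) (\<lambda>i. \<alpha> i + a i) - E) < \<epsilon> * col_width (m + p) ^ r"
proof -
  have s: "subboxes r m \<alpha> p \<subseteq> sets box_space_measure" for p
  proof
    fix A assume A: "A \<in> subboxes r m \<alpha> p"
    then show "A \<in> sets box_space_measure"
      using subboxes_sets[of p] subboxes_Union[of p] unfolding sets_box_space by blast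
  qed
  have "emeasure box_space_measure (E \<inter> level_box r m \<alpha>) > 0"
    using E(2) box_sets[OF m \<alpha>] by (subst emeasure_restrict_space) auto
  then have pos: "measure box_space_measure (E \<inter> level_box r m \<alpha>) > 0"
    by (simp add: emeasure_eq_measure)
  have "\<forall>\<^sub>F p in sequentially. \<exists>A\<in>subboxes r m \<alpha> p.
      measure box_space_measure (A - E \<inter> level_box r m \<alpha>) < \<epsilon> * measure box_space_measure A"
    using approximable_dense_atom[OF subboxes_finite subboxes_disjoint s _ approx_sets[OF E(1)] pos eps]
      subboxes_Union space_box_space by blast
  then show ?thesis
  proof eventually_elim
    case (elim p)
    then obtain a where a: "a \<in> (\<Pi>\<^sub>E i\<in>{..<r}. copies p m)"
      "measure box_space_measure (level_box r (m + p) (\<lambda>i. \<alpha> i + a i) - E \<inter> level_box r m \<alpha>) <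
        \<epsilon> * measure box_space_measure (level_box r (m + p) (\<lambda>i. \<alpha> i + a i))"
      by (auto simp: subboxes_def)
    let ?A = "level_box r (m + p) (\<lambda>i. \<alpha> i + a i)"
    have "?A \<in> subboxes r m \<alpha> p"
      using a(1) by (auto simp: subboxes_def)
    then have sub: "?A \<subseteq> level_box r m \<alpha>"
      using subboxes_Union[of p] by blast
    then have "?A - E \<inter> level_box r m \<alpha> = ?A - E" by blast
    moreover have "measure (power_space r) ?A = col_width (m + p) ^ r"
      using m subbox_index[OF a(1)] by (intro measure_box) auto
    ultimately show ?case
      using a sub by (intro bexI[of _ a]) (simp_all add: measure_box_space Diff_subset[THEN order_trans])
  qed
qed

end

end

section \<open>Products of powers of the transformation\<close>

lemma product_map_funpow:
  assumes "x \<in> extensional {..<r}"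
  shows "(product_map r f ^^ n) x = product_map r (\<lambda>i. f i ^^ n) x"
proof (induction n)
  case 0
  then show ?case using assms by (simp add: product_map_def extensional_restrict)
next
  case (Suc n)
  then show ?case by (auto simp: product_map_def fun_eq_iff)
qed

lemma AE_measure_preserving:
  assumes f: "measure_preserving_map M f" and P: "AE x in M. P x"
  shows "AE x in M. P (f x)"
proof -
  obtain N where N: "{x \<in> space M. \<not> P x} \<subseteq> N" "N \<in> null_sets M"
    using P by (auto simp: eventually_ae_filter)
  have "f x \<in> space M" if "x \<in> space M" for x
    using f that measurable_space by (auto simp: measure_preserving_map_def)
  then have "{x \<in> space M. \<not> P (f x)} \<subseteq> f -` N \<inter> space M"
    using N(1) by auto
  then show ?thesis
    using measure_preserving_map_null[OF f N(2)] unfolding eventually_ae_filter by (rule bexI)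
qed

text \<open>
  The inverse relation may fail on a null set; its preimages under the iterates are null as well.
\<close>

lemma AE_funpow_inverse:
  assumes f: "measure_preserving_map M f" and g: "AE x in M. g (f x) = x"
  shows "AE x in M. (g ^^ n) ((f ^^ n) x) = x"
proof (induction n)
  case (Suc n)
  have "AE x in M. g (f ((f ^^ n) x)) = (f ^^ n) x"
    using measure_preserving_map_funpow[OF f] g by (rule AE_measure_preserving)
  then show ?case
    using Suc
  proof eventually_elim
    case (elim x)
    then show ?case by (simp add: funpow_swap1[of g])
  qed
qed auto

lemma invariant_funpow_null:
  assumes F: "measure_preserving_map M F" and A: "A \<in> sets M"
    and inv: "sym_diff (F -` A \<inter> space M) A \<in> null_sets M"
  shows "\<exists>N\<in>null_sets M. {x \<in> A. (F ^^ n) x \<notin> A} \<subseteq> N"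
proof (induction n)
  case 0
  then show ?case by (intro bexI[of _ "{}"]) auto
next
  case (Suc n)
  then obtain N where N: "N \<in> null_sets M" "{x \<in> A. (F ^^ n) x \<notin> A} \<subseteq> N" by blast
  let ?N' = "(F ^^ n) -` sym_diff (F -` A \<inter> space M) A \<inter> space M"
  have "?N' \<in> null_sets M"
    using measure_preserving_map_funpow[OF F] inv by (rule measure_preserving_map_null)
  then have "N \<union> ?N' \<in> null_sets M"
    using N(1) by (rule null_sets.Un[rotated])
  moreover have "{x \<in> A. (F ^^ Suc n) x \<notin> A} \<subseteq> N \<union> ?N'"
    using N(2) sets.sets_into_space[OF A] by auto
  ultimately show ?case by blast
qed

lemma measure_preserving_map_fmeasurable:
  assumes f: "measure_preserving_map M f" and D: "D \<in> fmeasurable M"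
  shows "f -` D \<inter> space M \<in> fmeasurable M" "measure M (f -` D \<inter> space M) = measure M D"
  using assms by (auto simp: measure_preserving_map_def fmeasurable_def measure_def measurable_sets)

context columns
begin

lemma AE_T_power_inverse: "AE x in half_line. T_power (- z) (T_power z x) = x"
proof -
  have 1: "AE x in half_line. T_inv (T x) = x"
    using T_inv_T by (intro AE_I2) auto
  have "{x \<in> space half_line. T (T_inv x) \<noteq> x} \<subseteq> {0}"
  proof (rule subsetI)
    fix x assume "x \<in> {x \<in> space half_line. T (T_inv x) \<noteq> x}"
    then have x: "x \<ge> 0" "T (T_inv x) \<noteq> x"
      by simp_all
    then have "x \<notin> T ` {0..}"
      using T_T_inv by blast
    then have "\<not> x > 0"
      using T_image by blast
    with x(1) show "x \<in> {0}" by simp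
  qed
  then have 2: "AE x in half_line. T (T_inv x) = x"
    using zero_null by (auto simp: eventually_ae_filter)
  show ?thesis
    using AE_funpow_inverse[OF measure_preserving_T 1, of "nat z"]
      AE_funpow_inverse[OF measure_preserving_T_inv 2, of "nat (- z)"]
    by (cases "z = 0") (auto simp: int_power_on_def)
qed

abbreviation powers :: "nat \<Rightarrow> (nat \<Rightarrow> int) \<Rightarrow> (nat \<Rightarrow> real) \<Rightarrow> (nat \<Rightarrow> real)" where
  "powers r z \<equiv> product_map r (\<lambda>i. T_power (z i))"

lemma measure_preserving_powers: "measure_preserving_map (power_space r) (powers r z)"
  unfolding power_space_def
  by (intro measure_preserving_map_completion measure_preserving_map_product
      sigma_finite_half_line measure_preserving_T_power)

lemma AE_power_space_component:
  assumes P: "AE x in half_line. P x" and i: "i < r"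
  shows "AE x in power_space r. P (x i)"
proof -
  obtain N where N: "{x \<in> space half_line. \<not> P x} \<subseteq> N" "N \<in> null_sets half_line"
    using P by (auto simp: eventually_ae_filter)
  let ?B = "\<lambda>j. if j = i then N else {0..}"
  have B: "?B j \<in> sets half_line" for j
    using N(2) sets.top[of half_line] by auto
  have "(\<Prod>j<r. emeasure half_line (?B j)) = 0"
    using i N(2) by (intro prod_zero bexI[of _ i]) auto
  then have "emeasure (power_space r) (\<Pi>\<^sub>E j\<in>{..<r}. ?B j) = 0"
    using emeasure_power_space_PiE[of r ?B, OF B] by metis
  moreover have "(\<Pi>\<^sub>E j\<in>{..<r}. ?B j) \<in> sets (power_space r)"
    unfolding power_space_def using B by (intro sets_completionI_sets sets_PiM_I_finite) auto
  moreover have "{x \<in> space (power_space r). \<not> P (x i)} \<subseteq> (\<Pi>\<^sub>E j\<in>{..<r}. ?B j)"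
  proof
    fix x assume x: "x \<in> {x \<in> space (power_space r). \<not> P (x i)}"
    then have "x \<in> (\<Pi>\<^sub>E j\<in>{..<r}. {0..})"
      by (simp add: space_power_space)
    moreover from this have "x i \<in> N"
      using x N(1) i by (auto dest: PiE_mem)
    ultimately show "x \<in> (\<Pi>\<^sub>E j\<in>{..<r}. ?B j)"
      by (intro PiE_I) (auto dest: PiE_mem PiE_arb)
  qed
  ultimately show ?thesis
    by (intro AE_I[of _ _ "\<Pi>\<^sub>E j\<in>{..<r}. ?B j"]) auto
qed

lemma AE_powers_inverse: "AE x in power_space r. powers r (\<lambda>i. - z i) (powers r z x) = x"
proof -
  have "AE x in power_space r. \<forall>i\<in>{..<r}. T_power (- z i) (T_power (z i) (x i)) = x i"
    by (intro AE_finite_allI) (auto intro: AE_power_space_component AE_T_power_inverse)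
  then show ?thesis
  proof (rule AE_mp, intro AE_I2 impI)
    fix x assume "x \<in> space (power_space r)" "\<forall>i\<in>{..<r}. T_power (- z i) (T_power (z i) (x i)) = x i"
    then show "powers r (\<lambda>i. - z i) (powers r z x) = x"
      by (auto simp: product_map_def space_power_space fun_eq_iff PiE_iff extensional_def)
  qed
qed

lemma invertible_powers: "invertible_mod_null (power_space r) (powers r z)"
  unfolding invertible_mod_null_def
proof (intro bexI conjI)
  show "AE x in power_space r. powers r (\<lambda>i. - z i) (powers r z x) = x"
    by (rule AE_powers_inverse)
  show "AE x in power_space r. powers r z (powers r (\<lambda>i. - z i) x) = x"
    using AE_powers_inverse[of r "\<lambda>i. - z i"] by simp
  show "powers r (\<lambda>i. - z i) \<in> measurable (power_space r) (power_space r)"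
    using measure_preserving_powers by (simp add: measure_preserving_map_def)
qed

lemma powers_box:
  assumes "m \<ge> 1" "x \<in> level_box r m \<beta>"
    and "\<And>i. i < r \<Longrightarrow> \<beta> i < height m" "\<And>i. i < r \<Longrightarrow> \<gamma> i < height m" "\<And>i. i < r \<Longrightarrow> int (\<gamma> i) = int (\<beta> i) + z i"
  shows "powers r z x \<in> level_box r m \<gamma>"
  unfolding level_box_def product_map_def
proof (intro PiE_I)
  fix i assume i: "i \<in> {..<r}"
  have "x i \<in> lev m (\<beta> i)"
    using assms(2) i PiE_mem unfolding level_box_def by blast
  then show "(\<lambda>i\<in>{..<r}. T_power (z i) (x i)) i \<in> lev m (\<gamma> i)"
    using T_power_lev(2)[OF assms(1) _ assms(3-5)] i by simp
qed auto

lemma T_power_add_lev: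
  assumes "m \<ge> 1" "x \<in> lev m i" "i < height m" "j < height m" "l < height m" "int j = int i + z" "int l = int j + z'"
  shows "T_power (z + z') x = T_power z' (T_power z x)"
proof -
  have "T_power (z + z') x = x + (C m ! l - C m ! i)"
    using T_power_lev(1)[OF assms(1-3,5), of "z + z'"] assms by simp
  moreover have "T_power z x = x + (C m ! j - C m ! i)" "T_power z x \<in> lev m j"
    using T_power_lev[OF assms(1-4)] assms by auto
  moreover have "T_power z' (T_power z x) = T_power z x + (C m ! l - C m ! j)"
    using T_power_lev(1)[OF assms(1) calculation(3)] assms by simp
  ultimately show ?thesis by simp
qed

text \<open>
  Where the levels involved all exist in one column, the powers are translations and compose without an
  exceptional null set.
\<close>

lemma powers_add_box:
  assumes "m \<ge> 1" "x \<in> level_box r m \<beta>"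
    and "\<And>i. i < r \<Longrightarrow> \<beta> i < height m" "\<And>i. i < r \<Longrightarrow> \<gamma> i < height m" "\<And>i. i < r \<Longrightarrow> \<delta> i < height m"
    and "\<And>i. i < r \<Longrightarrow> int (\<gamma> i) = int (\<beta> i) + z i" "\<And>i. i < r \<Longrightarrow> int (\<delta> i) = int (\<gamma> i) + z' i"
  shows "powers r (\<lambda>i. z i + z' i) x = powers r z' (powers r z x)"
proof -
  have "T_power (z i + z' i) (x i) = T_power (z' i) (T_power (z i) (x i))" if i: "i < r" for i
  proof (rule T_power_add_lev[where m = m and j = "\<gamma> i" and l = "\<delta> i"])
    show "x i \<in> lev m (\<beta> i)"
      using assms(2) i PiE_mem unfolding level_box_def by blast
  qed (use assms i in auto)
  then show ?thesis
    by (auto simp: product_map_def fun_eq_iff)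
qed

section \<open>Ergodicity\<close>

lemma space_power_space_boxes:
  assumes "x \<in> space (power_space r)"
  shows "\<exists>m\<ge>1. \<exists>\<alpha>\<in>(\<Pi>\<^sub>E i\<in>{..<r}. {..<height m}). x \<in> level_box r m \<alpha>"
proof -
  have x: "x \<in> (\<Pi>\<^sub>E i\<in>{..<r}. {0..})"
    using assms by (simp add: space_power_space)
  then have "\<forall>i\<in>{..<r}. \<exists>k\<ge>1. x i \<in> tower k"
    using tower_exists PiE_mem[OF x] by auto
  then obtain k where k: "\<And>i. i < r \<Longrightarrow> k i \<ge> 1 \<and> x i \<in> tower (k i)"
    by (metis lessThan_iff)
  define m where "m = Suc (\<Sum>i<r. k i)"
  have "x i \<in> tower m" if "i < r" for i
  proof -
    have "k i \<le> (\<Sum>i<r. k i)"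
      using that by (intro member_le_sum) auto
    then show ?thesis
      using k[OF that] tower_mono[of "k i" m] by (auto simp: m_def)
  qed
  then have "\<forall>i\<in>{..<r}. \<exists>j<height m. x i \<in> lev m j"
    unfolding tower_def by blast
  then obtain \<alpha> where a: "\<And>i. i < r \<Longrightarrow> \<alpha> i < height m \<and> x i \<in> lev m (\<alpha> i)"
    by (metis lessThan_iff)
  have "x \<in> level_box r m (restrict \<alpha> {..<r})"
    using x a by (auto simp: level_box_def PiE_iff)
  then show ?thesis
    using a by (intro exI[of _ m] conjI bexI[of _ "restrict \<alpha> {..<r}"]) (auto simp: m_def)
qed

lemma positive_box:
  assumes E: "E \<in> sets (power_space r)" "E \<notin> null_sets (power_space r)"
  obtains m \<alpha> where "m \<ge> 1" "\<And>i. i < r \<Longrightarrow> \<alpha> i < height m" "emeasure (power_space r) (E \<inter> level_box r m \<alpha>) > 0"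
proof -
  have "\<exists>m\<ge>1. \<exists>\<alpha>\<in>(\<Pi>\<^sub>E i\<in>{..<r}. {..<height m}). emeasure (power_space r) (E \<inter> level_box r m \<alpha>) > 0"
  proof (rule ccontr)
    assume none: "\<not> ?thesis"
    have "E = (\<Union>m\<in>{1..}. \<Union>\<alpha>\<in>(\<Pi>\<^sub>E i\<in>{..<r}. {..<height m}). E \<inter> level_box r m \<alpha>)"
      using space_power_space_boxes sets.sets_into_space[OF E(1)] by fastforce
    also have "\<dots> \<in> null_sets (power_space r)"
    proof (intro null_sets_UN')
      fix m \<alpha> assume m: "m \<in> {1..}" "\<alpha> \<in> (\<Pi>\<^sub>E i\<in>{..<r}. {..<height m})"
      then have "E \<inter> level_box r m \<alpha> \<in> sets (power_space r)"
        using E(1) by (intro sets.Int box_sets) auto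
      moreover have "emeasure (power_space r) (E \<inter> level_box r m \<alpha>) = 0"
        using none m by (auto simp: not_gr_zero)
      ultimately show "E \<inter> level_box r m \<alpha> \<in> null_sets (power_space r)" by auto
    qed (auto intro: countable_finite finite_PiE)
    finally show False using E(2) by simp
  qed
  then show ?thesis using that by (metis PiE_mem lessThan_iff)
qed

text \<open>
  Density at every late stage is what permits a common stage for two different sets.
\<close>

lemma dense_box:
  assumes E: "E \<in> sets (power_space r)" "E \<notin> null_sets (power_space r)" and eps: "\<epsilon> > 0"
  shows "\<forall>\<^sub>F m in sequentially. \<exists>\<alpha>. (\<forall>i<r. \<alpha> i < height m) \<and>
    measure (power_space r) (level_box r m \<alpha> - E) < \<epsilon> * col_width m ^ r"
proof -
  obtain m \<alpha> where m: "m \<ge> 1" and \<alpha>: "\<And>i. i < r \<Longrightarrow> \<alpha> i < height m"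
    and pos: "emeasure (power_space r) (E \<inter> level_box r m \<alpha>) > 0"
    using positive_box[OF E] by blast
  obtain N where N: "\<And>p. p \<ge> N \<Longrightarrow> \<exists>a\<in>(\<Pi>\<^sub>E i\<in>{..<r}. copies p m).
    measure (power_space r) (level_box r (m + p) (\<lambda>i. \<alpha> i + a i) - E) < \<epsilon> * col_width (m + p) ^ r"
    using dense_subbox[OF m \<alpha> E(1) pos eps] unfolding eventually_sequentially by blast
  have "\<exists>\<alpha>. (\<forall>i<r. \<alpha> i < height m') \<and> measure (power_space r) (level_box r m' \<alpha> - E) < \<epsilon> * col_width m' ^ r"
    if "m' \<ge> m + N" for m'
  proof -
    define p where "p = m' - m"
    have p: "m' = m + p" "p \<ge> N"
      using that by (simp_all add: p_def)
    obtain a where a: "a \<in> (\<Pi>\<^sub>E i\<in>{..<r}. copies p m)"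
      "measure (power_space r) (level_box r m' (\<lambda>i. \<alpha> i + a i) - E) < \<epsilon> * col_width m' ^ r"
      using N[OF p(2)] unfolding p(1) by blast
    then show ?thesis
      using subbox_index[OF m \<alpha> a(1)] p(1) by (intro exI[of _ "\<lambda>i. \<alpha> i + a i"]) auto
  qed
  then show ?thesis
    unfolding eventually_sequentially by blast
qed

lemma box_fmeasurable:
  "m \<ge> 1 \<Longrightarrow> (\<And>i. i < r \<Longrightarrow> \<alpha> i < height m) \<Longrightarrow> level_box r m \<alpha> \<in> fmeasurable (power_space r)"
  using box_sets[of m r \<alpha>] emeasure_box[of m r \<alpha>] by (auto simp: fmeasurable_def)

lemma col_width_add: "m \<ge> 1 \<Longrightarrow> col_width (m + p) = col_width m / 4 ^ p"
  by (cases m) (auto simp: col_width_def power_add)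

text \<open>
  The density argument sketched at the beginning: a \<open>3/4\<close>-full pair of boxes fixes the displacement
  \<open>d\<close>, this fixes \<open>p\<close>, and only then the density of \<open>E\<close> is chosen, relative to \<open>p\<close>.
\<close>

lemma powers_not_separating:
  fixes k :: "nat \<Rightarrow> int"
  assumes k: "\<And>i. i < r \<Longrightarrow> k i \<noteq> 0"
    and A: "A \<in> sets (power_space r)" "A \<notin> null_sets (power_space r)"
    and B: "B \<in> sets (power_space r)" "B \<notin> null_sets (power_space r)"
  shows "\<exists>n. \<not> (\<exists>N\<in>null_sets (power_space r). {x \<in> A. (powers r k ^^ n) x \<in> B} \<subseteq> N)"
proof -
  let ?M = "power_space r"
  have "\<forall>\<^sub>F m in sequentially. m \<ge> 1 \<and>
      (\<exists>\<alpha>. (\<forall>i<r. \<alpha> i < height m) \<and> measure ?M (level_box r m \<alpha> - A) < 1/4 * col_width m ^ r) \<and>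
      (\<exists>\<beta>. (\<forall>i<r. \<beta> i < height m) \<and> measure ?M (level_box r m \<beta> - B) < 1/4 * col_width m ^ r)"
    by (intro eventually_conj eventually_ge_at_top dense_box A B) auto
  then obtain m \<alpha> \<beta> where m: "m \<ge> 1"
    and \<alpha>: "\<And>i. i < r \<Longrightarrow> \<alpha> i < height m" "measure ?M (level_box r m \<alpha> - A) < 1/4 * col_width m ^ r"
    and \<beta>: "\<And>i. i < r \<Longrightarrow> \<beta> i < height m" "measure ?M (level_box r m \<beta> - B) < 1/4 * col_width m ^ r"
    by (blast dest: eventually_happens'[OF sequentially_bot])
  define d where "d i = int (\<beta> i) - int (\<alpha> i)" for i
  let ?G = "powers r d"
  have G: "measure_preserving_map ?M ?G"
    by (rule measure_preserving_powers)
  have Gm: "?G -` X \<inter> space ?M \<in> sets ?M" if "X \<in> sets ?M" for X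
    using G that measurable_sets by (auto simp: measure_preserving_map_def)
  define E where "E = A \<inter> (?G -` B \<inter> space ?M)"
  have Em: "E \<in> sets ?M"
    unfolding E_def using A(1) Gm[OF B(1)] by blast
  have level_box: "level_box r m \<alpha> \<in> fmeasurable ?M" "level_box r m \<beta> \<in> fmeasurable ?M"
    using box_fmeasurable m \<alpha>(1) \<beta>(1) by auto
  have boxDiff: "level_box r m \<alpha> - A \<in> fmeasurable ?M" "level_box r m \<beta> - B \<in> fmeasurable ?M"
    using level_box A(1) B(1) by (auto intro: fmeasurable_Diff)
  have wpos: "col_width l ^ r > 0" for l
    using col_width_pos by simp
  \<comment> \<open>The complement of \<open>E\<close> in the first box is covered by two sets that each take up less than a quarter.\<close>
  have pos: "emeasure ?M (E \<inter> level_box r m \<alpha>) > 0"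
  proof (rule ccontr)
    assume "\<not> ?thesis"
    then have "E \<inter> level_box r m \<alpha> \<in> null_sets ?M"
      using Em level_box by (auto simp: null_sets_def not_gr_zero)
    then have "measure ?M (level_box r m \<alpha> - E \<inter> level_box r m \<alpha>) = measure ?M (level_box r m \<alpha>)"
      using level_box by (intro measure_Diff_null_set) auto
    then have "col_width m ^ r = measure ?M (level_box r m \<alpha> - E \<inter> level_box r m \<alpha>)"
      using measure_box[OF m \<alpha>(1)] by simp
    also have "\<dots> \<le> measure ?M ((level_box r m \<alpha> - A) \<union> (?G -` (level_box r m \<beta> - B) \<inter> space ?M))"
    proof (rule measure_mono_fmeasurable)
      show "level_box r m \<alpha> - E \<inter> level_box r m \<alpha> \<subseteq> (level_box r m \<alpha> - A) \<union> (?G -` (level_box r m \<beta> - B) \<inter> space ?M)"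
      proof
        fix x assume x: "x \<in> level_box r m \<alpha> - E \<inter> level_box r m \<alpha>"
        then have xb: "x \<in> level_box r m \<alpha>" by blast
        have "?G x \<in> level_box r m \<beta>"
          by (rule powers_box[OF m xb]) (use \<alpha>(1) \<beta>(1) in \<open>auto simp: d_def\<close>)
        moreover have "x \<in> space ?M"
          using box_space[of m r \<alpha>] m \<alpha>(1) xb by blast
        ultimately show "x \<in> (level_box r m \<alpha> - A) \<union> (?G -` (level_box r m \<beta> - B) \<inter> space ?M)"
          using x by (auto simp: E_def)
      qed
      show "level_box r m \<alpha> - E \<inter> level_box r m \<alpha> \<in> sets ?M"
        using level_box Em by (intro sets.Diff sets.Int) auto
      show "(level_box r m \<alpha> - A) \<union> (?G -` (level_box r m \<beta> - B) \<inter> space ?M) \<in> fmeasurable ?M"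
        using boxDiff by (intro fmeasurable.Un measure_preserving_map_fmeasurable(1)[OF G])
    qed
    also have "\<dots> \<le> measure ?M (level_box r m \<alpha> - A) + measure ?M (?G -` (level_box r m \<beta> - B) \<inter> space ?M)"
      using level_box A(1) B(1) Gm by (intro measure_Un_le) auto
    also have "measure ?M (?G -` (level_box r m \<beta> - B) \<inter> space ?M) = measure ?M (level_box r m \<beta> - B)"
      using boxDiff(2) by (rule measure_preserving_map_fmeasurable(2)[OF G])
    finally show False
      using \<alpha>(2) \<beta>(2) wpos[of m] by simp
  qed
  obtain p t where pt: "\<And>m i. m \<ge> 1 \<Longrightarrow> i < r \<Longrightarrow> copy_distance p m (k i * int (height m + t) - d i)"
    using simultaneous_copy_distances[of r k d] k by blast
  \<comment> \<open>A box of column \<open>l + p\<close> takes up the fraction \<open>4\<^sup>-\<^sup>p\<^sup>r\<close> of a box of column \<open>l\<close>. With less than a third of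
    this missing, twice the missing part does not cover the small box.\<close>
  define \<epsilon> :: real where "\<epsilon> = (1 / 4 ^ p) ^ r / 3"
  have "\<epsilon> > 0" by (simp add: \<epsilon>_def)
  then obtain q a where a: "a \<in> (\<Pi>\<^sub>E i\<in>{..<r}. copies q m)"
    and dense: "measure ?M (level_box r (m + q) (\<lambda>i. \<alpha> i + a i) - E) < \<epsilon> * col_width (m + q) ^ r"
    using eventually_happens'[OF sequentially_bot dense_subbox[OF m \<alpha>(1) Em pos]] by blast
  define l where "l = m + q"
  define \<gamma> where "\<gamma> i = \<alpha> i + a i" for i
  have l: "l \<ge> 1" using m by (simp add: l_def)
  have \<gamma>: "\<gamma> i < height l" if "i < r" for i
    using subbox_index[OF m \<alpha>(1) a that] by (simp add: l_def \<gamma>_def)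
  have \<gamma>d: "\<beta> i + a i < height l" if "i < r" for i
    using subbox_index[OF m \<beta>(1) a that] by (simp add: l_def)
  define n where "n = height l + t"
  have "\<forall>i\<in>{..<r}. \<exists>c b. c \<in> copies p l \<and> b \<in> copies p l \<and> int c = int b + (k i * int n - d i)"
    using pt[OF l] unfolding copy_distance_def n_def by blast
  then obtain c b where cb: "\<And>i. i < r \<Longrightarrow> c i \<in> copies p l" "\<And>i. i < r \<Longrightarrow> b i \<in> copies p l"
    "\<And>i. i < r \<Longrightarrow> int (c i) = int (b i) + (k i * int n - d i)"
    by (metis lessThan_iff)
  let ?H = "powers r (\<lambda>i. k i * int n - d i)"
  have H: "measure_preserving_map ?M ?H"
    by (rule measure_preserving_powers)
  \<comment> \<open>The map \<open>?H\<close> translates \<open>?Pb\<close> to \<open>?Pc\<close>, and both lie in the box that \<open>E\<close> nearly fills.\<close>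
  let ?Pb = "level_box r (l + p) (\<lambda>i. \<gamma> i + b i)" and ?Pc = "level_box r (l + p) (\<lambda>i. \<gamma> i + c i)"
  have lp: "l + p \<ge> 1" using l by simp
  have idx: "\<gamma> i + b i < height (l + p)" "\<gamma> i + c i < height (l + p)" "\<beta> i + a i + c i < height (l + p)"
    and sub: "lev (l + p) (\<gamma> i + b i) \<subseteq> lev l (\<gamma> i)" "lev (l + p) (\<gamma> i + c i) \<subseteq> lev l (\<gamma> i)"
    if "i < r" for i
    using copies_nested[OF l] \<gamma> \<gamma>d cb that by blast+
  have Pb: "?Pb \<in> sets ?M" "?Pb \<subseteq> space ?M" "measure ?M ?Pb = col_width (l + p) ^ r"
    using lp idx(1) by (intro box_sets box_space measure_box; blast)+
  have Psub: "?Pb \<subseteq> level_box r l \<gamma>" "?Pc \<subseteq> level_box r l \<gamma>"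
    unfolding level_box_def using sub by (auto intro!: PiE_mono)
  define D where "D = level_box r l \<gamma> - E"
  have Dm: "D \<in> fmeasurable ?M" "measure ?M D < \<epsilon> * col_width l ^ r"
  proof -
    show "D \<in> fmeasurable ?M"
      unfolding D_def using l \<gamma> Em by (intro fmeasurable_Diff box_fmeasurable)
    show "measure ?M D < \<epsilon> * col_width l ^ r"
      using dense unfolding D_def l_def \<gamma>_def .
  qed
  have HD: "?H -` D \<inter> space ?M \<in> fmeasurable ?M" "measure ?M (?H -` D \<inter> space ?M) = measure ?M D"
    using measure_preserving_map_fmeasurable[OF H Dm(1)] by auto
  \<comment> \<open>On the small box the \<open>n\<close>-th iterate is \<open>?H\<close> followed by \<open>?G\<close>; after \<open>?H\<close> the point is still in
    \<open>E\<close>, hence after \<open>?G\<close> it is in \<open>B\<close>.\<close>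
  have key: "x \<in> {x \<in> A. (powers r k ^^ n) x \<in> B}"
    if x: "x \<in> ?Pb" "x \<notin> D" "x \<notin> ?H -` D \<inter> space ?M" for x
  proof -
    have sp: "x \<in> space ?M"
      using Pb(2) x(1) by blast
    have "?H x \<in> ?Pc"
      using powers_box[OF lp x(1) idx(1,2)] cb(3) by simp
    then have "x \<in> E" "?H x \<in> E"
      using x sp Psub unfolding D_def by auto
    then have "x \<in> A" "?G (?H x) \<in> B"
      by (auto simp: E_def)
    moreover have "powers r (\<lambda>i. k i * int n - d i + d i) x = ?G (?H x)"
      by (rule powers_add_box[OF lp x(1) idx]) (use cb(3) in \<open>auto simp: d_def \<gamma>_def\<close>)
    moreover have "(powers r k ^^ n) x = powers r (\<lambda>i. k i * int n) x"
      using sp by (subst product_map_funpow) (auto simp: T_power_mult space_power_space PiE_iff)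
    ultimately show ?thesis by simp
  qed
  have "\<not> (\<exists>N\<in>null_sets ?M. {x \<in> A. (powers r k ^^ n) x \<in> B} \<subseteq> N)"
  proof
    assume "\<exists>N\<in>null_sets ?M. {x \<in> A. (powers r k ^^ n) x \<in> B} \<subseteq> N"
    then obtain N where N: "N \<in> null_sets ?M" "{x \<in> A. (powers r k ^^ n) x \<in> B} \<subseteq> N" by blast
    have Nf: "N \<in> fmeasurable ?M" "measure ?M N = 0"
      using N(1) by (auto simp: fmeasurable_def null_sets_def measure_def)
    have "col_width (l + p) ^ r = measure ?M ?Pb"
      by (rule Pb(3)[symmetric])
    also have "\<dots> \<le> measure ?M ((D \<union> (?H -` D \<inter> space ?M)) \<union> N)"
    proof (intro measure_mono_fmeasurable fmeasurable.Un)
      show "?Pb \<subseteq> (D \<union> (?H -` D \<inter> space ?M)) \<union> N"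
        using key N(2) by blast
    qed (rule Pb(1) Dm(1) HD(1) Nf(1))+
    also have "\<dots> \<le> measure ?M (D \<union> (?H -` D \<inter> space ?M)) + measure ?M N"
      using Dm(1) HD(1) Nf(1) by (intro measure_Un_le) auto
    also have "\<dots> \<le> measure ?M D + measure ?M (?H -` D \<inter> space ?M) + measure ?M N"
      using Dm(1) HD(1) by (intro add_right_mono measure_Un_le) auto
    also have "\<dots> < 2 * \<epsilon> * col_width l ^ r"
      using Dm(2) HD(2) Nf(2) by simp
    also have "\<dots> = 2 / 3 * col_width (l + p) ^ r"
      by (simp add: \<epsilon>_def col_width_add[OF l] power_divide)
    finally show False
      using wpos[of "l + p"] by simp
  qed
  then show ?thesis by blast
qed

lemma ergodic_powers:
  assumes k: "\<And>i. i < r \<Longrightarrow> k i \<noteq> 0"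
  shows "ergodic_map (power_space r) (powers r k)"
  unfolding ergodic_map_def
proof (intro conjI ballI impI)
  let ?M = "power_space r"
  show mp: "measure_preserving_map ?M (powers r k)"
    by (rule measure_preserving_powers)
  show "invertible_mod_null ?M (powers r k)"
    by (rule invertible_powers)
  fix A assume A: "A \<in> sets ?M" and inv: "sym_diff (powers r k -` A \<inter> space ?M) A \<in> null_sets ?M"
  show "A \<in> null_sets ?M \<or> space ?M - A \<in> null_sets ?M"
  proof (rule ccontr)
    assume "\<not> ?thesis"
    then obtain n where n: "\<not> (\<exists>N\<in>null_sets ?M. {x \<in> A. (powers r k ^^ n) x \<in> space ?M - A} \<subseteq> N)"
      using powers_not_separating[of r k A "space ?M - A"] k A sets.compl_sets[OF A] by blast
    obtain N where "N \<in> null_sets ?M" "{x \<in> A. (powers r k ^^ n) x \<notin> A} \<subseteq> N"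
      using invariant_funpow_null[OF mp A inv] by blast
    then show False using n by blast
  qed
qed

end

theorem theorem3p1:
  fixes C :: "nat \<Rightarrow> real list" and ks :: "int list"
  assumes "column_sequence C"
    and "ks \<noteq> []"
    and "0 \<notin> set ks"
  shows "ergodic_map (power_space (length ks))
           (product_map (length ks) (\<lambda>i. int_power_on {0..} (cs_map C) (ks ! i)))"
proof -
  interpret columns C
    using assms(1) by (rule columns.intro)
  show ?thesis
    using assms(3) by (intro ergodic_powers) (metis nth_mem)
qed

end
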